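(* Suppose that Assumption A holds. For $(z,\lambda)$, let $\mathcal A_+$ be the index set returned by Procedure ID0 at $(z,\lambda)$, and consider the linear program in $(\hat t,\hat\lambda)\in\mathbb R\times\mathbb R^m$ $$\max_{\hat t,\hat\lambda}\ \hat t\quad\text{subject to}\quad \hat t\le\hat\lambda_i\ \ (i\in\mathcal A_+),\qquad -\eta(z,\lambda)^\tau e\le\nabla\phi(z)+\sum_{i\in\mathcal A_+}\hat\lambda_i\nabla g_i(z)\le\eta(z,\lambda)^\tau e,\qquad \hat\lambda_i\ge0\ (i\in\mathcal A_+),\quad\hat\lambda_i=0\ \text{otherwise}.\tag{LP}$$ Then there is a positive number $\delta_3$ such that (LP) is feasible and bounded whenever $\delta(z,\lambda)\le\delta_3$, and its optimal objective is at least $\epsilon_\lambda$. Moreover, there is a constant $\beta'>0$ such that $\delta(z,\hat\lambda)\le\beta'\,\delta(z,\lambda)^\tau$, where $\hat\lambda$ is the multiplier part of the solution of (LP).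
   Context: **Problem.** $\min_z\phi(z)$ subject to $g(z)\le 0$, with $\phi:\mathbb R^n\to\mathbb R$, $g:\mathbb R^n\to\mathbb R^m$ twice Lipschitz continuously differentiable. Lagrangian: $\mathcal L(z,\lambda)=\phi(z)+\lambda^Tg(z)$; $\mathcal L_z,\mathcal L_{zz}$ are its gradient and Hessian in $z$. KKT conditions at $z^*$: there is $\lambda^*\in\mathbb R^m$ with $\mathcal L_z(z^*,\lambda^* )=0$, $g(z^* )\le0$, $\lambda^*\ge0$, $(\lambda^* )^Tg(z^* )=0$. $\mathcal S_\lambda$ is the set of all $\lambda^*$ satisfying the KKT conditions at the fixed point $z^*$, and $\mathcal S=\{z^*\}\times\mathcal S_\lambda$. $\mathcal B=\{i: g_i(z^* )=0\}$; $\mathcal B_+=\{i\in\mathcal B:\lambda^*_i>0\text{ for some }\lambda^*\in\mathcal S_\lambda\}$; $\mathcal B_0=\mathcal B\setminus\mathcal B_+$. $\epsilon_\lambda=\max_{\lambda^*\in\mathcal S_\lambda}\min_{i\in\mathcal B_+}\lambda^*_i$ (positive by the definition of $\mathcal B_+$). **Assumption A.** (i) The KKT conditions hold at $z^*$. (ii) MFCQ: there is $\bar y\in\mathbb R^n$ with $\nabla g_i(z^* )^T\bar y<0$ for all $i\in\mathcal B$. (iii) There is $\alpha>0$ such that $w^T\mathcal L_{zz}(z^*,\lambda^* )w\ge\alpha\|w\|^2$ for all $\lambda^*\in\mathcal S_\lambda$ and all $w$ with $\nabla g_i(z^* )^Tw=0$ for $i\in\mathcal B_+$ and $\nabla g_i(z^*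 )^Tw\le0$ for $i\in\mathcal B_0$. (iv) $\phi$ and $g$ are twice Lipschitz continuously differentiable in a neighborhood of $z^*$. **Distances.** $\|\cdot\|$ is the Euclidean norm, $\delta(z,\lambda)=\operatorname{dist}((z,\lambda),\mathcal S)$, and $\eta(z,\lambda)=\left\|\begin{pmatrix}\mathcal L_z(z,\lambda)\\ \min(\lambda,-g(z))\end{pmatrix}\right\|$ with the min taken componentwise. $\mathcal A(z,\lambda)=\{i: g_i(z)\ge-\eta(z,\lambda)^\tau\}$. $e$ is the vector of ones; vector inequalities are componentwise. The constants $\tau,\hat\tau$ are given with $0<\hat\tau<\tau<1$. **Procedure ID0** at $(z,\lambda)$. Set $\hat{\mathcal A}=\hat{\mathcal A}_{\rm init}=\mathcal A(z,\lambda)\setminus\{i:\lambda_i\ge\eta(z,\lambda)^{\hat\tau}\}$. Repeat: solve the linear program $$\max_{\tilde\lambda}\sum_{i\in\hat{\mathcal A}}\tilde\lambda_i\ \text{ s.t. }\ -\eta(z,\lambda)^\tau e\le\nabla\phi(z)+\sum_{i\in\mathcal A(z,\lambda)}\tilde\lambda_i\nabla g_i(z)\le\eta(z,\lambda)^\tau e,\ \tilde\lambda_i\ge0\ (i\in\mathcal A(z,\lambda)),\ \tilde\lambda_i=0\text{ otherwise}$$ to find $\tilde\lambda$; set $\mathcal C=\{i\in\hat{\mathcal A}:\tilde\lambda_i\ge\eta(z,\lambda)^{\hat\tau}\}$; if $\mathcal C=\emptyset$, stop with $\mathcal A_0=\hat{\mathcal A}$, $\mathcal A_+=\mathcal A(z,\lambda)\setminus\hat{\mathcal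 A}$; otherwise replace $\hat{\mathcal A}$ by $\hat{\mathcal A}\setminus\mathcal C$, and if it is now empty stop with $\mathcal A_0=\emptyset$, $\mathcal A_+=\mathcal A(z,\lambda)$.
   Formalization: B_+ is assumed nonempty (otherwise ε_λ is undefined), and the bound "optimal objective at least ε_λ" is claimed only for 0 < δ(z,λ) ≤ δ_3: at points of S, η = 0 gives A_+ = B, and the optimum is 0 < ε_λ if B_0 is nonempty. *)

theory Defs
  imports "HOL-Analysis.Analysis"
begin

section \<open>Gradients, Hessians, smoothness\<close>

definition grad :: "('a::real_inner \<Rightarrow> real) \<Rightarrow> 'a \<Rightarrow> 'a" where
  "grad f x = (THE d. GDERIV f x :> d)"

lemma grad_eq: "GDERIV f x :> d \<Longrightarrow> grad f x = d"
proof -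
  assume d: "GDERIV f x :> d"
  have "d' = d" if "GDERIV f x :> d'" for d'
  proof -
    have "(\<lambda>h. inner h d') = (\<lambda>h. inner h d)"
      using that d unfolding gderiv_def by (rule has_derivative_unique)
    then have "inner h (d' - d) = 0" for h
      by (metis inner_diff_right right_minus_eq)
    then show ?thesis
      using inner_eq_zero_iff right_minus_eq by blast
  qed
  with d show "grad f x = d"
    unfolding grad_def by blast
qed

definition hess :: "(real^'n \<Rightarrow> real) \<Rightarrow> real^'n \<Rightarrow> real^'n^'n" where
  "hess f x = jacobian (grad f) (at x)"

definition twice_lipschitz_C2_on :: "(real^'n) set \<Rightarrow> (real^'n \<Rightarrow> real) \<Rightarrow> bool" where
  "twice_lipschitz_C2_on U f \<longleftrightarrow>
     (\<forall>x\<in>U. f differentiable (at x)) \<and>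
     (\<forall>x\<in>U. grad f differentiable (at x)) \<and>
     (\<exists>L. L-lipschitz_on U (hess f))"


section \<open>The nonlinear program\<close>

text \<open>
  The problem is to minimise \<open>\<phi> z\<close> subject to \<open>g z \<le> 0\<close>. The order on
  \<open>real^'n\<close> and \<open>real^'m\<close> is the componentwise one, and \<open>1\<close> is the vector of ones.
\<close>

definition lagr :: "(real^'n \<Rightarrow> real) \<Rightarrow> (real^'n \<Rightarrow> real^'m) \<Rightarrow> real^'n \<Rightarrow> real^'m \<Rightarrow> real" where
  "lagr \<phi> g z l = \<phi> z + l \<bullet> g z"

definition lagr_z :: "(real^'n \<Rightarrow> real) \<Rightarrow> (real^'n \<Rightarrow> real^'m) \<Rightarrow> real^'n \<Rightarrow> real^'m \<Rightarrow> real^'n" where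
  "lagr_z \<phi> g z l = grad (\<lambda>x. lagr \<phi> g x l) z"

definition lagr_zz :: "(real^'n \<Rightarrow> real) \<Rightarrow> (real^'n \<Rightarrow> real^'m) \<Rightarrow> real^'n \<Rightarrow> real^'m \<Rightarrow> real^'n^'n" where
  "lagr_zz \<phi> g z l = hess (\<lambda>x. lagr \<phi> g x l) z"

definition grad_con :: "(real^'n \<Rightarrow> real^'m) \<Rightarrow> 'm \<Rightarrow> real^'n \<Rightarrow> real^'n" where
  "grad_con g i z = grad (\<lambda>x. g x $ i) z"

definition KKT_multipliers ::
    "(real^'n \<Rightarrow> real) \<Rightarrow> (real^'n \<Rightarrow> real^'m) \<Rightarrow> real^'n \<Rightarrow> (real^'m) set" where
  "KKT_multipliers \<phi> g zs =
     {l. lagr_z \<phi> g zs l = 0 \<and> g zs \<le> 0 \<and> 0 \<le> l \<and> l \<bullet> g zs = 0}"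

definition KKT_set ::
    "(real^'n \<Rightarrow> real) \<Rightarrow> (real^'n \<Rightarrow> real^'m) \<Rightarrow> real^'n \<Rightarrow> ((real^'n) \<times> (real^'m)) set" where
  "KKT_set \<phi> g zs = {zs} \<times> KKT_multipliers \<phi> g zs"

definition active :: "(real^'n \<Rightarrow> real^'m) \<Rightarrow> real^'n \<Rightarrow> 'm set" where
  "active g zs = {i. g zs $ i = 0}"

definition active_plus ::
    "(real^'n \<Rightarrow> real) \<Rightarrow> (real^'n \<Rightarrow> real^'m) \<Rightarrow> real^'n \<Rightarrow> 'm set" where
  "active_plus \<phi> g zs = {i \<in> active g zs. \<exists>l \<in> KKT_multipliers \<phi> g zs. l $ i > 0}"

definition active_zero ::
    "(real^'n \<Rightarrow> real) \<Rightarrow> (real^'n \<Rightarrow> real^'m) \<Rightarrow> real^'n \<Rightarrow> 'm set" where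
  "active_zero \<phi> g zs = active g zs - active_plus \<phi> g zs"

text \<open>
  Under the Mangasarian-Fromovitz condition the multiplier set is compact, so the supremum
  below is a maximum. It is meaningful only when \<open>active_plus \<phi> g zs\<close> is nonempty.
\<close>

definition eps_lambda ::
    "(real^'n \<Rightarrow> real) \<Rightarrow> (real^'n \<Rightarrow> real^'m) \<Rightarrow> real^'n \<Rightarrow> real" where
  "eps_lambda \<phi> g zs =
     (SUP l \<in> KKT_multipliers \<phi> g zs. Min ((\<lambda>i. l $ i) ` active_plus \<phi> g zs))"


section \<open>Standing assumption\<close>

definition MFCQ :: "(real^'n \<Rightarrow> real^'m) \<Rightarrow> real^'n \<Rightarrow> bool" where
  "MFCQ g zs \<longleftrightarrow> (\<exists>y. \<forall>i \<in> active g zs. grad_con g i zs \<bullet> y < 0)"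

definition second_order_sufficient ::
    "(real^'n \<Rightarrow> real) \<Rightarrow> (real^'n \<Rightarrow> real^'m) \<Rightarrow> real^'n \<Rightarrow> bool" where
  "second_order_sufficient \<phi> g zs \<longleftrightarrow>
     (\<exists>\<alpha>>0. \<forall>l \<in> KKT_multipliers \<phi> g zs. \<forall>w.
        (\<forall>i \<in> active_plus \<phi> g zs. grad_con g i zs \<bullet> w = 0) \<and>
        (\<forall>i \<in> active_zero \<phi> g zs. grad_con g i zs \<bullet> w \<le> 0) \<longrightarrow>
        w \<bullet> (lagr_zz \<phi> g zs l *v w) \<ge> \<alpha> * (norm w)\<^sup>2)"

definition assumption_A ::
    "(real^'n \<Rightarrow> real) \<Rightarrow> (real^'n \<Rightarrow> real^'m) \<Rightarrow> real^'n \<Rightarrow> bool" where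
  "assumption_A \<phi> g zs \<longleftrightarrow>
     KKT_multipliers \<phi> g zs \<noteq> {} \<and>
     MFCQ g zs \<and>
     second_order_sufficient \<phi> g zs \<and>
     (\<exists>U. open U \<and> zs \<in> U \<and> twice_lipschitz_C2_on U \<phi> \<and>
          (\<forall>i. twice_lipschitz_C2_on U (\<lambda>z. g z $ i)))"


section \<open>Distance and residual\<close>

text \<open>The norm on a product type is the Euclidean norm of the stacked vector.\<close>

definition dist_KKT ::
    "(real^'n \<Rightarrow> real) \<Rightarrow> (real^'n \<Rightarrow> real^'m) \<Rightarrow> real^'n \<Rightarrow> real^'n \<Rightarrow> real^'m \<Rightarrow> real" where
  "dist_KKT \<phi> g zs z l = infdist (z, l) (KKT_set \<phi> g zs)"

definition eta ::
    "(real^'n \<Rightarrow> real) \<Rightarrow> (real^'n \<Rightarrow> real^'m) \<Rightarrow> real^'n \<Rightarrow> real^'m \<Rightarrow> real" where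
  "eta \<phi> g z l = norm (lagr_z \<phi> g z l, (\<chi> i. min (l $ i) (- (g z $ i))) :: real^'m)"

definition est_active ::
    "(real^'n \<Rightarrow> real) \<Rightarrow> (real^'n \<Rightarrow> real^'m) \<Rightarrow> real \<Rightarrow> real^'n \<Rightarrow> real^'m \<Rightarrow> 'm set" where
  "est_active \<phi> g \<tau> z l = {i. g z $ i \<ge> - (eta \<phi> g z l powr \<tau>)}"


section \<open>Procedure ID0\<close>

text \<open>
  \<open>mult_feasible \<phi> g \<tau> z l I\<close> is the constraint set on multipliers shared by the linear
  programs: supported on \<open>I\<close>, nonnegative, and approximately stationary at \<open>z\<close>. The pair
  \<open>(z, l)\<close> enters through the tolerance \<open>eta \<phi> g z l powr \<tau>\<close>.
\<close>

definition mult_feasible ::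
    "(real^'n \<Rightarrow> real) \<Rightarrow> (real^'n \<Rightarrow> real^'m) \<Rightarrow> real \<Rightarrow> real^'n \<Rightarrow> real^'m \<Rightarrow> 'm set \<Rightarrow> (real^'m) set" where
  "mult_feasible \<phi> g \<tau> z l I = {u.
     - ((eta \<phi> g z l powr \<tau>) *\<^sub>R 1) \<le> grad \<phi> z + (\<Sum>i\<in>I. u $ i *\<^sub>R grad_con g i z) \<and>
     grad \<phi> z + (\<Sum>i\<in>I. u $ i *\<^sub>R grad_con g i z) \<le> (eta \<phi> g z l powr \<tau>) *\<^sub>R 1 \<and>
     (\<forall>i\<in>I. 0 \<le> u $ i) \<and> (\<forall>i. i \<notin> I \<longrightarrow> u $ i = 0)}"

definition ID0_init ::
    "(real^'n \<Rightarrow> real) \<Rightarrow> (real^'n \<Rightarrow> real^'m) \<Rightarrow> real \<Rightarrow> real \<Rightarrow> real^'n \<Rightarrow> real^'m \<Rightarrow> 'm set" where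
  "ID0_init \<phi> g \<tau> \<tau>' z l = est_active \<phi> g \<tau> z l - {i. l $ i \<ge> eta \<phi> g z l powr \<tau>'}"

definition ID0_LP_solution ::
    "(real^'n \<Rightarrow> real) \<Rightarrow> (real^'n \<Rightarrow> real^'m) \<Rightarrow> real \<Rightarrow> real^'n \<Rightarrow> real^'m \<Rightarrow> 'm set \<Rightarrow> real^'m \<Rightarrow> bool" where
  "ID0_LP_solution \<phi> g \<tau> z l H u \<longleftrightarrow>
     is_arg_max (\<lambda>v. \<Sum>i\<in>H. v $ i)
       (\<lambda>v. v \<in> mult_feasible \<phi> g \<tau> z l (est_active \<phi> g \<tau> z l)) u"

definition ID0_C ::
    "(real^'n \<Rightarrow> real) \<Rightarrow> (real^'n \<Rightarrow> real^'m) \<Rightarrow> real \<Rightarrow> real^'n \<Rightarrow> real^'m \<Rightarrow> 'm set \<Rightarrow> real^'m \<Rightarrow> 'm set" where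
  "ID0_C \<phi> g \<tau>' z l H u = {i \<in> H. u $ i \<ge> eta \<phi> g z l powr \<tau>'}"

text \<open>
  The linear programs may have several solutions, so the procedure is a relation:
  \<open>ID0_loop \<phi> g \<tau> \<tau>' z l H A0 Ap\<close> says that the loop, entered with working set \<open>H\<close>,
  can stop with the pair of index sets \<open>(A0, Ap)\<close>.
\<close>

inductive ID0_loop ::
    "(real^'n \<Rightarrow> real) \<Rightarrow> (real^'n \<Rightarrow> real^'m) \<Rightarrow> real \<Rightarrow> real \<Rightarrow> real^'n \<Rightarrow> real^'m \<Rightarrow>
     'm set \<Rightarrow> 'm set \<Rightarrow> 'm set \<Rightarrow> bool"
  for \<phi> :: "real^'n \<Rightarrow> real" and g :: "real^'n \<Rightarrow> real^'m" and \<tau> \<tau>' :: real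
    and z :: "real^'n" and l :: "real^'m"
  where
  stop_C_empty:
    "ID0_LP_solution \<phi> g \<tau> z l H u \<Longrightarrow> ID0_C \<phi> g \<tau>' z l H u = {} \<Longrightarrow>
     ID0_loop \<phi> g \<tau> \<tau>' z l H H (est_active \<phi> g \<tau> z l - H)"
| stop_H_empty:
    "ID0_LP_solution \<phi> g \<tau> z l H u \<Longrightarrow> ID0_C \<phi> g \<tau>' z l H u \<noteq> {} \<Longrightarrow>
     H - ID0_C \<phi> g \<tau>' z l H u = {} \<Longrightarrow>
     ID0_loop \<phi> g \<tau> \<tau>' z l H {} (est_active \<phi> g \<tau> z l)"
| repeat:
    "ID0_LP_solution \<phi> g \<tau> z l H u \<Longrightarrow> ID0_C \<phi> g \<tau>' z l H u \<noteq> {} \<Longrightarrow>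
     H - ID0_C \<phi> g \<tau>' z l H u \<noteq> {} \<Longrightarrow>
     ID0_loop \<phi> g \<tau> \<tau>' z l (H - ID0_C \<phi> g \<tau>' z l H u) A0 Ap \<Longrightarrow>
     ID0_loop \<phi> g \<tau> \<tau>' z l H A0 Ap"

definition ID0_returns ::
    "(real^'n \<Rightarrow> real) \<Rightarrow> (real^'n \<Rightarrow> real^'m) \<Rightarrow> real \<Rightarrow> real \<Rightarrow> real^'n \<Rightarrow> real^'m \<Rightarrow>
     'm set \<Rightarrow> 'm set \<Rightarrow> bool" where
  "ID0_returns \<phi> g \<tau> \<tau>' z l A0 Ap \<longleftrightarrow>
     ID0_loop \<phi> g \<tau> \<tau>' z l (ID0_init \<phi> g \<tau> \<tau>' z l) A0 Ap"


section \<open>The multiplier linear program\<close>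

definition LP_feasible ::
    "(real^'n \<Rightarrow> real) \<Rightarrow> (real^'n \<Rightarrow> real^'m) \<Rightarrow> real \<Rightarrow> real^'n \<Rightarrow> real^'m \<Rightarrow> 'm set \<Rightarrow>
     (real \<times> (real^'m)) set" where
  "LP_feasible \<phi> g \<tau> z l Ap =
     {(t, u). (\<forall>i\<in>Ap. t \<le> u $ i) \<and> u \<in> mult_feasible \<phi> g \<tau> z l Ap}"

definition LP_solution ::
    "(real^'n \<Rightarrow> real) \<Rightarrow> (real^'n \<Rightarrow> real^'m) \<Rightarrow> real \<Rightarrow> real^'n \<Rightarrow> real^'m \<Rightarrow> 'm set \<Rightarrow>
     real \<times> (real^'m) \<Rightarrow> bool" where
  "LP_solution \<phi> g \<tau> z l Ap p \<longleftrightarrow> is_arg_max fst (\<lambda>q. q \<in> LP_feasible \<phi> g \<tau> z l Ap) p"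

definition LP_value ::
    "(real^'n \<Rightarrow> real) \<Rightarrow> (real^'n \<Rightarrow> real^'m) \<Rightarrow> real \<Rightarrow> real^'n \<Rightarrow> real^'m \<Rightarrow> 'm set \<Rightarrow> real" where
  "LP_value \<phi> g \<tau> z l Ap = Sup (fst ` LP_feasible \<phi> g \<tau> z l Ap)"

end

(*
  The tolerance eta^tau vanishes more slowly than the distance delta to the KKT set, provided that
  eta and delta are of the same order. The upper bound eta = O(delta) is Lipschitz continuity. For
  delta = O(eta), the multiplier part is Hoffman's bound for the polyhedron of multipliers, and the
  primal part |z - zs| = O(eta) follows from the second-order condition: if eta were small against
  |z - zs|, the direction z - zs would be almost critical with almost nonpositive curvature.

  Hence near the KKT set, but off it, the estimated active set is exact, every KKT multiplier
  is feasible for the linear programs, and every feasible point is within O(eta^tau) of a KKT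
  multiplier. The latter keeps weakly active indices below the threshold eta^tau' in ID0, the former
  forces ID0 to continue while a strongly active index is left, so A_+ = B_+. All claims follow.
  At points of the KKT set itself eta = 0, ID0 stops at once, and A_+ is the whole active set.
*)
theory Submission
  imports Defs
begin

section \<open>Differentiability and norm estimates\<close>

text \<open>The two halves of delta = O(eta) depend on each other:
  \<open>M_local_error_bound\<close> controls multipliers only up to \<open>norm (z - zs)\<close>,
  while the second-order argument needs a multiplier close to \<open>l\<close>. The way out is
  \<open>shifted_multiplier\<close>, which keeps \<open>norm (z - zs)\<close> on its right-hand
  side. If eta < \<kappa> * \<open>norm (z - zs)\<close> is assumed for contradiction, the
  multiplier error is O(\<open>norm (z - zs)\<close>), which is just enough; afterwards the primal
  bound is put back into it. Under MFCQ multipliers need not be unique, so several occur at once: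
  one close to \<open>l\<close>, one close to the shifted \<open>l\<close>, and for each strongly
  active index one that is positive there. They can be exchanged in first-order terms because all
  satisfy the same stationarity equation at \<open>zs\<close>. Hoffman's constant is used at
  \<open>zs\<close> only, since it need not stay bounded when the constraint gradients move with z;
  the perturbation is absorbed in the estimate instead. The strict order 1 > \<tau> > \<tau>' lets
  each gap between exponents swallow an arbitrary constant.\<close>

lemma gderiv_grad:
  fixes f :: "'a::euclidean_space \<Rightarrow> real"
  assumes "f differentiable (at x)"
  shows "GDERIV f x :> grad f x"
proof -
  obtain f' where f': "(f has_derivative f') (at x)"
    using assms unfolding differentiable_def by blast
  interpret linear f' using f' by (rule has_derivative_linear)
  have "f' h = h \<bullet> (\<Sum>b\<in>Basis. f' b *\<^sub>R b)" for h
  proof -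
    have "f' h = f' (\<Sum>b\<in>Basis. (h \<bullet> b) *\<^sub>R b)" by (simp add: euclidean_representation)
    also have "\<dots> = h \<bullet> (\<Sum>b\<in>Basis. f' b *\<^sub>R b)"
      by (simp add: sum scale inner_sum_right mult.commute)
    finally show ?thesis .
  qed
  then have "f' = (\<lambda>h. h \<bullet> (\<Sum>b\<in>Basis. f' b *\<^sub>R b))" by blast
  then have "GDERIV f x :> (\<Sum>b\<in>Basis. f' b *\<^sub>R b)"
    using f' unfolding gderiv_def by simp
  then show ?thesis using grad_eq by metis
qed

lemma hess_has_derivative:
  assumes "grad f differentiable (at x)"
  shows "(grad f has_derivative (\<lambda>h. hess f x *v h)) (at x)"
  using assms unfolding hess_def by (simp add: jacobian_works)

lemma frechet_remainder:
  assumes "(f has_derivative f') (at x)" "0 < e"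
  shows "\<exists>d>0. \<forall>y. norm (y - x) \<le> d \<longrightarrow> norm (f y - f x - f' (y - x)) \<le> e * norm (y - x)"
proof -
  obtain d where "d > 0"
    "\<forall>y. norm (y - x) < d \<longrightarrow> norm (f y - f x - f' (y - x)) \<le> e * norm (y - x)"
    using assms unfolding has_derivative_at_alt by blast
  then show ?thesis by (intro exI[of _ "d/2"]) auto
qed

lemma uniform_radius:
  fixes P :: "'i::finite \<Rightarrow> 'a::real_normed_vector \<Rightarrow> bool"
  assumes "\<forall>i. \<exists>d>0::real. \<forall>y. norm (y - x) \<le> d \<longrightarrow> P i y"
  shows "\<exists>d>0. \<forall>y. norm (y - x) \<le> d \<longrightarrow> (\<forall>i. P i y)"
proof -
  from assms obtain d where d: "\<And>i. d i > 0" "\<And>i y. norm (y - x) \<le> d i \<Longrightarrow> P i y"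
    by metis
  have "Min (range d) > 0" using d(1) by auto
  moreover have "\<forall>y. norm (y - x) \<le> Min (range d) \<longrightarrow> (\<forall>i. P i y)"
    using d(2) by (meson Min_le finite finite_imageI order_trans rangeI)
  ultimately show ?thesis by blast
qed

lemma norm_sum_scaleR_le:
  fixes u :: "real^'m" and v :: "'m \<Rightarrow> 'b::real_normed_vector" and c :: real
  assumes "\<And>i. norm (v i) \<le> c"
  shows "norm (\<Sum>i\<in>UNIV. u$i *\<^sub>R v i) \<le> CARD('m) * c * norm u"
proof -
  have "norm (\<Sum>i\<in>UNIV. u$i *\<^sub>R v i) \<le> (\<Sum>i\<in>(UNIV::'m set). norm u * c)"
    by (rule sum_norm_le)
       (auto intro!: mult_mono assms component_le_norm_cart order_trans[OF norm_ge_zero assms])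
  then show ?thesis by (simp add: ac_simps)
qed

lemma norm_le_card_mult:
  fixes v :: "real^'n" and c :: real
  assumes "\<And>i. \<bar>v$i\<bar> \<le> c"
  shows "norm v \<le> CARD('n) * c"
  using order_trans[OF norm_le_l1_cart sum_mono[of UNIV "\<lambda>i. \<bar>v$i\<bar>" "\<lambda>i. c"]] assms by simp

section \<open>Hoffman's bound\<close>

text \<open>
  If \<open>p\<close> is the solution nearest to \<open>x\<close>, no nonzero kernel vector of \<open>f\<close> can
  have the sign pattern of \<open>x - p\<close>, since moving \<open>p\<close> along it would stay nonnegative and come
  closer to \<open>x\<close>. So \<open>f\<close> is bounded below on each of the finitely many sign cones that occur.
\<close>

definition sign_cone :: "'m set \<times> 'm set \<Rightarrow> (real^'m) set" where
  "sign_cone ST = {e. (\<forall>i\<in>fst ST. 0 \<le> e$i) \<and> (\<forall>i\<in>snd ST. e$i \<le> 0) \<and>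
                      (\<forall>i. i \<notin> fst ST \<longrightarrow> i \<notin> snd ST \<longrightarrow> e$i = 0)}"

lemma closed_sign_cone: "closed (sign_cone ST)"
proof -
  have "sign_cone ST = (\<Inter>i\<in>fst ST. {e. 0 \<le> e$i}) \<inter> (\<Inter>i\<in>snd ST. {e. e$i \<le> 0}) \<inter>
      (\<Inter>i\<in>- (fst ST \<union> snd ST). {e. e$i = 0})"
    unfolding sign_cone_def by auto
  then show ?thesis
    by (auto intro!: closed_Int closed_INT closed_Collect_le closed_Collect_eq continuous_intros)
qed

lemma sign_cone_lower_bound:
  fixes f :: "real^'m \<Rightarrow> 'b::euclidean_space"
  assumes f: "linear f" and ker: "\<forall>e\<in>sign_cone ST. f e = 0 \<longrightarrow> e = 0"
  shows "\<exists>c>0. \<forall>e\<in>sign_cone ST. norm e \<le> c * norm (f e)"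
proof -
  let ?K = "sign_cone ST \<inter> sphere 0 1"
  interpret linear f by fact
  have K: "compact ?K" by (intro closed_Int_compact closed_sign_cone compact_sphere)
  have normalize: "e /\<^sub>R norm e \<in> ?K" if "e \<in> sign_cone ST" "e \<noteq> 0" for e
    using that by (auto simp: sign_cone_def mult_nonneg_nonpos)
  show ?thesis
  proof (cases "?K = {}")
    case True
    \<comment> \<open>An empty slice means that the cone is {0}, so any constant serves.\<close>
    then have "\<forall>e\<in>sign_cone ST. norm e \<le> 1 * norm (f e)" using normalize by force
    then show ?thesis using zero_less_one by blast
  next
    case False
    have "continuous_on ?K (\<lambda>e. norm (f e))"
      by (intro continuous_intros linear_continuous_on linear_conv_bounded_linear[THEN iffD1] f)
    from continuous_attains_inf[OF K False this]
    obtain e0 where e0: "e0 \<in> ?K" "\<forall>e\<in>?K. norm (f e0) \<le> norm (f e)" by blast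
    have pos: "0 < norm (f e0)" using e0(1) ker by auto
    have "norm e \<le> inverse (norm (f e0)) * norm (f e)" if "e \<in> sign_cone ST" for e
    proof (cases "e = 0")
      case False
      then have "norm (f e0) \<le> norm (f (e /\<^sub>R norm e))" using e0(2) normalize[OF that] by blast
      then have "norm (f e0) \<le> norm (f e) / norm e" by (simp add: scale divide_inverse_commute)
      then show ?thesis using pos False by (simp add: field_simps)
    qed simp
    then show ?thesis using pos positive_imp_inverse_positive by blast
  qed
qed

lemma nearest_sign_pattern:
  fixes f :: "real^'m \<Rightarrow> 'b::euclidean_space" and x p :: "real^'m"
  assumes f: "linear f" and x: "0 \<le> x" and p: "0 \<le> p"
    and near: "\<And>q. 0 \<le> q \<Longrightarrow> f q = f p \<Longrightarrow> norm (x - p) \<le> norm (x - q)"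
    and e: "e \<in> sign_cone ({i. p$i < x$i}, {i. x$i < p$i})" "f e = 0"
  shows "e = 0"
proof (rule ccontr)
  interpret linear f by fact
  assume "e \<noteq> 0"
  \<comment> \<open>Agreement of signs makes every summand of \<open>e \<bullet> (x - p)\<close>
    nonnegative, and a summand vanishes only where \<open>e\<close> does.\<close>
  have sgn: "0 \<le> e$i * (x - p)$i" "e$i * (x-p)$i = 0 \<Longrightarrow> e$i = 0" for i
    using e(1) unfolding sign_cone_def by (cases "x$i" "p$i" rule: linorder_cases; force simp: mult_nonpos_nonpos)+
  then have "0 \<le> e \<bullet> (x - p)" unfolding inner_vec_def by (simp add: sum_nonneg)
  moreover have "e \<bullet> (x - p) \<noteq> 0"
  proof
    assume "e \<bullet> (x - p) = 0"
    then have "\<forall>i. e$i * (x - p)$i = 0"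
      using sgn(1) unfolding inner_vec_def by (simp add: sum_nonneg_eq_0_iff)
    then have "e = 0" using sgn(2) by (simp add: vec_eq_iff)
    with \<open>e \<noteq> 0\<close> show False ..
  qed
  ultimately have ip: "0 < e \<bullet> (x - p)" by simp
  have "\<exists>d>0. \<forall>t. 0 < t \<and> t \<le> d \<longrightarrow> 0 \<le> p$i + t * e$i" for i
  proof (cases "0 \<le> e$i")
    case True
    then show ?thesis using p by (intro exI[of _ 1]) (auto simp: less_eq_vec_def)
  next
    case False
    \<comment> \<open>A negative component of \<open>e\<close> occurs only where \<open>p\<close>
      exceeds \<open>x \<ge> 0\<close>, so there is room to decrease \<open>p\<close>.\<close>
    then have "x$i < p$i" using e(1) unfolding sign_cone_def by (cases "x$i" "p$i" rule: linorder_cases) auto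
    then have "0 < p$i" using x by (auto simp: less_eq_vec_def intro: le_less_trans)
    with False show ?thesis
      by (intro exI[of _ "p$i / - (e$i)"]) (auto simp: field_simps divide_neg_neg divide_pos_neg)
  qed
  then have "\<forall>i. \<exists>d>0. \<forall>t. 0 < t \<and> t \<le> d \<longrightarrow> 0 \<le> p$i + t * e$i" by blast
  then obtain d where d: "\<And>i. 0 < d i" "\<And>i t. 0 < t \<Longrightarrow> t \<le> d i \<Longrightarrow> 0 \<le> p$i + t * e$i"
    by metis
  \<comment> \<open>The second bound is the minimiser of the distance from \<open>x\<close> along
    the ray from \<open>p\<close> in direction \<open>e\<close>. Not stepping beyond it makes the
    squared distance drop by at least \<open>t * (e \<bullet> (x - p))\<close>.\<close>
  define t where "t = min (Min (range d)) (e \<bullet> (x - p) / (e \<bullet> e))"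
  have ee: "0 < e \<bullet> e" using \<open>e \<noteq> 0\<close> by simp
  have Min_d: "0 < Min (range d)" "\<And>i. Min (range d) \<le> d i" using d(1) by auto
  have t: "0 < t" "\<And>i. t \<le> d i" unfolding t_def
    using Min_d ip ee by (auto intro: min.coboundedI1)
  have "t \<le> e \<bullet> (x - p) / (e \<bullet> e)" unfolding t_def by simp
  then have te: "t * (e \<bullet> e) \<le> e \<bullet> (x - p)" using ee by (simp add: pos_le_divide_eq)
  have "0 \<le> p + t *\<^sub>R e" using d(2) t by (simp add: less_eq_vec_def)
  moreover have "f (p + t *\<^sub>R e) = f p" using e(2) by (simp add: add scale)
  ultimately have "norm (x - p) \<le> norm (x - (p + t *\<^sub>R e))" by (rule near)
  then have "(x - p) \<bullet> (x - p) \<le> (x - (p + t *\<^sub>R e)) \<bullet> (x - (p + t *\<^sub>R e))"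
    by (simp add: norm_le)
  also have "\<dots> = (x - p) \<bullet> (x - p) - 2 * t * (e \<bullet> (x - p)) + t * (t * (e \<bullet> e))"
    by (simp add: algebra_simps inner_commute)
  also have "\<dots> \<le> (x - p) \<bullet> (x - p) - 2 * t * (e \<bullet> (x - p)) + t * (e \<bullet> (x - p))"
    using t(1) te by simp
  finally show False using mult_pos_pos[OF t(1) ip] by simp
qed

lemma hoffman_bound:
  fixes f :: "real^'m \<Rightarrow> 'b::euclidean_space"
  assumes f: "linear f" and ex: "0 \<le> p0" "f p0 = b"
  shows "\<exists>C>0. \<forall>x\<ge>0. \<exists>p\<ge>0. f p = b \<and> norm (x - p) \<le> C * norm (f x - b)"
proof -
  interpret linear f by fact
  define good where "good ST \<longleftrightarrow> (\<forall>e\<in>sign_cone ST. f e = 0 \<longrightarrow> e = 0)" for ST :: "'m set \<times> 'm set"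
  have "\<forall>ST. \<exists>c>0. good ST \<longrightarrow> (\<forall>e\<in>sign_cone ST. norm e \<le> c * norm (f e))"
    using sign_cone_lower_bound[OF f] zero_less_one unfolding good_def by metis
  then obtain c where c: "\<And>ST. c ST > 0"
    "\<And>ST e. good ST \<Longrightarrow> e \<in> sign_cone ST \<Longrightarrow> norm e \<le> c ST * norm (f e)" by metis
  \<comment> \<open>The pattern depends on \<open>x\<close>, but there are only finitely many, and
    those that occur are \<open>good\<close>; hence one constant for all \<open>x\<close>.\<close>
  let ?C = "Max (range c)"
  have C: "c ST \<le> ?C" for ST by simp
  let ?P = "{p. 0 \<le> p \<and> f p = b}"
  have "closed ?P"
  proof -
    have "?P = (\<Inter>i. {p. 0 \<le> p$i}) \<inter> {p. f p = b}" by (auto simp: less_eq_vec_def)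
    moreover have "continuous_on UNIV f"
      by (intro linear_continuous_on linear_conv_bounded_linear[THEN iffD1] f)
    ultimately show ?thesis
      by (auto intro!: closed_Int closed_INT closed_Collect_le closed_Collect_eq continuous_intros)
  qed
  have "\<exists>p\<ge>0. f p = b \<and> norm (x - p) \<le> ?C * norm (f x - b)" if x: "0 \<le> x" for x
  proof -
    obtain p where p: "p \<in> ?P" "\<And>q. q \<in> ?P \<Longrightarrow> dist x p \<le> dist x q"
      using distance_attains_inf[OF \<open>closed ?P\<close>, of x] ex by blast
    let ?ST = "({i. p$i < x$i}, {i. x$i < p$i})"
    have "good ?ST" unfolding good_def
      using nearest_sign_pattern[OF f x, of p] p by (auto simp: dist_norm)
    moreover have "x - p \<in> sign_cone ?ST" unfolding sign_cone_def by auto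
    ultimately have "norm (x - p) \<le> c ?ST * norm (f (x - p))" by (rule c(2))
    also have "\<dots> \<le> ?C * norm (f (x - p))" using C by (intro mult_right_mono) auto
    finally show ?thesis using p(1) by (auto simp: diff)
  qed
  moreover have "0 < ?C" using c(1) C by (meson less_le_trans)
  ultimately show ?thesis by blast
qed

section \<open>Local Lipschitz bounds and comparison of powers\<close>

lemma has_derivative_imp_local_lipschitz:
  assumes "(f has_derivative f') (at x)"
  shows "\<exists>K. \<exists>d>0. \<forall>y. norm (y - x) \<le> d \<longrightarrow> norm (f y - f x) \<le> K * norm (y - x)"
proof -
  obtain d where d: "d > 0"
    "\<And>y. norm (y - x) \<le> d \<Longrightarrow> norm (f y - f x - f' (y - x)) \<le> 1 * norm (y - x)"
    using frechet_remainder[OF assms zero_less_one] by blast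
  obtain K where K: "\<And>h. norm (f' h) \<le> norm h * K"
    using has_derivative_bounded_linear[OF assms] bounded_linear.bounded by blast
  have "norm (f y - f x) \<le> (K + 1) * norm (y - x)" if "norm (y - x) \<le> d" for y
    using d(2)[OF that] K[of "y - x"] norm_triangle_sub[of "f y - f x" "f' (y - x)"]
    by (simp add: algebra_simps)
  then show ?thesis using d(1) by blast
qed

text \<open>Every smallness condition on the residual in the identification argument has this shape,
  with exponents 0 and 1 standing for constants and linear terms. Stated as a filter, finitely many
  conditions yield a common threshold by conjunction.\<close>

lemma powr_dominates:
  fixes a b X :: real
  assumes "a < b"
  shows "eventually (\<lambda>x. X * x powr b < x powr a) (at_right 0)"
proof -
  have "((\<lambda>x. x powr (b - a)) \<longlongrightarrow> 0) (at_right (0::real))"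
    using assms eventually_at_right_less[of "0::real"]
    by (intro tendsto_zero_powrI[OF tendsto_ident_at tendsto_const]) (auto elim: eventually_mono)
  then have "((\<lambda>x. X * x powr (b - a)) \<longlongrightarrow> 0) (at_right 0)"
    by (rule tendsto_mult_right_zero)
  then have "eventually (\<lambda>x. X * x powr (b - a) < 1) (at_right 0)"
    by (rule order_tendstoD) simp
  moreover have "eventually (\<lambda>x::real. 0 < x) (at_right 0)" by (rule eventually_at_right_less)
  ultimately show ?thesis
  proof eventually_elim
    case (elim x)
    then have "X * x powr (b - a) * x powr a < 1 * x powr a" by (intro mult_strict_right_mono) auto
    also have "X * x powr (b - a) * x powr a = X * x powr b" by (simp add: mult.assoc flip: powr_add)
    finally show ?case by simp
  qed
qed

section \<open>Procedure ID0\<close>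

lemma ID0_LP_solution_exists:
  assumes "compact (mult_feasible \<phi> g \<tau> z l (est_active \<phi> g \<tau> z l))"
    "mult_feasible \<phi> g \<tau> z l (est_active \<phi> g \<tau> z l) \<noteq> {}"
  shows "\<exists>u. ID0_LP_solution \<phi> g \<tau> z l H u"
proof -
  have "continuous_on (mult_feasible \<phi> g \<tau> z l (est_active \<phi> g \<tau> z l)) (\<lambda>v. \<Sum>i\<in>H. v $ i)"
    by (intro continuous_intros)
  from continuous_attains_sup[OF assms this] show ?thesis
    unfolding ID0_LP_solution_def is_arg_max_linorder by blast
qed

text \<open>Each repetition removes a nonempty part of the working set, so its cardinality
  decreases. Without such a run, statements about all returned sets would be vacuous.\<close>

lemma ID0_loop_exists:
  assumes sol: "\<And>H. \<exists>u. ID0_LP_solution \<phi> g \<tau> z l H u"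
  shows "\<exists>A0 Ap. ID0_loop \<phi> g \<tau> \<tau>' z l H A0 Ap"
proof (induction "card H" arbitrary: H rule: less_induct)
  case less
  obtain u where u: "ID0_LP_solution \<phi> g \<tau> z l H u" using sol by blast
  let ?C = "ID0_C \<phi> g \<tau>' z l H u"
  consider "?C = {}" | "?C \<noteq> {}" "H - ?C = {}" | "?C \<noteq> {}" "H - ?C \<noteq> {}" by blast
  then show ?case
  proof cases
    case 3
    have "H - ?C \<subset> H" using 3(1) unfolding ID0_C_def by blast
    then have "card (H - ?C) < card H" by (simp add: psubset_card_mono)
    then show ?thesis using less ID0_loop.repeat[OF u 3] by blast
  qed (use ID0_loop.stop_C_empty ID0_loop.stop_H_empty u in blast)+
qed

text \<open>Loop invariant:
  \<open>Z \<subseteq> H \<subseteq> est_active \<phi> g \<tau> z l\<close>. By \<open>keep\<close>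
  no removal touches \<open>Z\<close>, and by \<open>progress\<close> the loop can stop with empty
  \<open>C\<close> only at \<open>H = Z\<close>; running out of indices forces
  \<open>Z = {}\<close>. It is applied with \<open>Z\<close> the weakly active indices.\<close>

lemma ID0_loop_result:
  assumes "ID0_loop \<phi> g \<tau> \<tau>' z l H A0 Ap" "Z \<subseteq> H" "H \<subseteq> est_active \<phi> g \<tau> z l"
    and keep: "\<And>H u. ID0_LP_solution \<phi> g \<tau> z l H u \<Longrightarrow> Z \<inter> ID0_C \<phi> g \<tau>' z l H u = {}"
    and progress: "\<And>H u. ID0_LP_solution \<phi> g \<tau> z l H u \<Longrightarrow> H \<subseteq> est_active \<phi> g \<tau> z l \<Longrightarrow>
      ID0_C \<phi> g \<tau>' z l H u = {} \<Longrightarrow> H \<subseteq> Z"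
  shows "Ap = est_active \<phi> g \<tau> z l - Z"
  using assms(1-3)
proof (induction rule: ID0_loop.induct)
  case (stop_C_empty H u)
  then show ?case using progress by blast
next
  case (stop_H_empty H u)
  then show ?case using keep[OF stop_H_empty(1)] by blast
next
  case (repeat H u A0 Ap)
  then show ?case using keep[OF repeat(1)] by blast
qed

section \<open>Error bounds at a KKT point\<close>

locale kkt_point =
  fixes \<phi> :: "real^'n \<Rightarrow> real" and g :: "real^'n \<Rightarrow> real^'m" and zs :: "real^'n"
  assumes assumption_A: "assumption_A \<phi> g zs"
begin

abbreviation "M \<equiv> KKT_multipliers \<phi> g zs"
abbreviation "B \<equiv> active g zs"
abbreviation "Bp \<equiv> active_plus \<phi> g zs"
abbreviation "B0 \<equiv> active_zero \<phi> g zs"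

definition grad_comb :: "real^'n \<Rightarrow> real^'m \<Rightarrow> real^'n" where
  "grad_comb z u = (\<Sum>i\<in>UNIV. u$i *\<^sub>R grad_con g i z)"

text \<open>Explicit gradient of the Lagrangian, affine in the multiplier. It is identified with
  \<open>lagr_z\<close> only near \<open>zs\<close>, where the data are known to be
  differentiable.\<close>

definition res :: "real^'n \<Rightarrow> real^'m \<Rightarrow> real^'n" where
  "res z u = grad \<phi> z + grad_comb z u"

definition hess_comb :: "real^'m \<Rightarrow> real^'n \<Rightarrow> real^'n" where
  "hess_comb u w = (\<Sum>i\<in>UNIV. u$i *\<^sub>R (hess (\<lambda>x. g x $ i) zs *v w))"

lemma linear_grad_comb: "linear (grad_comb z)"
  unfolding grad_comb_def
  by (intro linearI) (simp_all add: scaleR_add_left sum.distrib scaleR_sum_right)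

lemma linear_hess_comb: "linear (\<lambda>u. hess_comb u w)"
  unfolding hess_comb_def
  by (intro linearI) (simp_all add: scaleR_add_left sum.distrib scaleR_sum_right)

lemma grad_comb_inner: "grad_comb z u \<bullet> w = (\<Sum>i\<in>UNIV. u$i * (grad_con g i z \<bullet> w))"
  unfolding grad_comb_def by (simp add: inner_sum_left)

section \<open>Derivatives and expansions of the data at the KKT point\<close>

lemma smooth:
  obtains U where "open U" "zs \<in> U"
    "\<And>x. x \<in> U \<Longrightarrow> GDERIV \<phi> x :> grad \<phi> x"
    "\<And>x i. x \<in> U \<Longrightarrow> GDERIV (\<lambda>z. g z $ i) x :> grad_con g i x"
    "(grad \<phi> has_derivative (\<lambda>h. hess \<phi> zs *v h)) (at zs)"
    "\<And>i. (grad_con g i has_derivative (\<lambda>h. hess (\<lambda>x. g x $ i) zs *v h)) (at zs)"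
proof -
  obtain U where U: "open U" "zs \<in> U" "twice_lipschitz_C2_on U \<phi>"
      "\<And>i. twice_lipschitz_C2_on U (\<lambda>z. g z $ i)"
    using assumption_A unfolding assumption_A_def by blast
  have "grad_con g i = grad (\<lambda>x. g x $ i)" for i unfolding grad_con_def by blast
  with U show ?thesis
    by (intro that[of U]) (auto simp: twice_lipschitz_C2_on_def intro!: gderiv_grad hess_has_derivative)
qed

lemma gderiv_lagr:
  assumes "GDERIV \<phi> x :> grad \<phi> x" "\<And>i. GDERIV (\<lambda>z. g z $ i) x :> grad_con g i x"
  shows "lagr_z \<phi> g x l = res x l"
proof -
  have "((\<lambda>x. \<phi> x + (\<Sum>i\<in>UNIV. l$i * g x $ i)) has_derivative
        (\<lambda>h. h \<bullet> grad \<phi> x + (\<Sum>i\<in>UNIV. l$i * (h \<bullet> grad_con g i x)))) (at x)"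
    using assms unfolding gderiv_def
    by (intro has_derivative_add has_derivative_sum has_derivative_mult_right) auto
  moreover have "(\<lambda>h. h \<bullet> grad \<phi> x + (\<Sum>i\<in>UNIV. l$i * (h \<bullet> grad_con g i x))) = (\<lambda>h. h \<bullet> res x l)"
    by (simp add: res_def grad_comb_def inner_add_right inner_sum_right)
  ultimately have "GDERIV (\<lambda>x. lagr \<phi> g x l) x :> res x l"
    unfolding gderiv_def lagr_def inner_vec_def by simp
  then show ?thesis unfolding lagr_z_def by (rule grad_eq)
qed

lemma lagr_z_eq:
  "\<exists>\<rho>>0. \<forall>z. norm (z - zs) \<le> \<rho> \<longrightarrow> (\<forall>l. lagr_z \<phi> g z l = res z l)"
proof -
  obtain U where U: "open U" "zs \<in> U"
    "\<And>x. x \<in> U \<Longrightarrow> GDERIV \<phi> x :> grad \<phi> x"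
    "\<And>x i. x \<in> U \<Longrightarrow> GDERIV (\<lambda>z. g z $ i) x :> grad_con g i x"
    by (rule smooth) blast
  obtain \<rho> where "\<rho> > 0" "cball zs \<rho> \<subseteq> U" using open_contains_cball U(1,2) by blast
  then show ?thesis using gderiv_lagr U(3,4)
    by (intro exI[of _ \<rho>]) (auto simp: subset_iff dist_norm norm_minus_commute)
qed

lemma lagr_z_at: "lagr_z \<phi> g zs l = res zs l"
  using lagr_z_eq by force

text \<open>The Hessian differentiates the function \<open>grad\<close> of the Lagrangian, so that
  function has to agree with \<open>res\<close> on a neighbourhood of \<open>zs\<close> before the
  derivative can be transferred.\<close>

lemma lagr_zz_eq: "lagr_zz \<phi> g zs l *v w = hess \<phi> zs *v w + hess_comb l w"
proof -
  obtain U where U: "open U" "zs \<in> U"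
    "\<And>x. x \<in> U \<Longrightarrow> GDERIV \<phi> x :> grad \<phi> x"
    "\<And>x i. x \<in> U \<Longrightarrow> GDERIV (\<lambda>z. g z $ i) x :> grad_con g i x"
    "(grad \<phi> has_derivative (\<lambda>h. hess \<phi> zs *v h)) (at zs)"
    "\<And>i. (grad_con g i has_derivative (\<lambda>h. hess (\<lambda>x. g x $ i) zs *v h)) (at zs)"
    by (rule smooth) blast
  have "((\<lambda>x. res x l) has_derivative (\<lambda>w. hess \<phi> zs *v w + hess_comb l w)) (at zs)"
    unfolding res_def grad_comb_def hess_comb_def
    by (intro has_derivative_add has_derivative_sum has_derivative_scaleR_right U)
  then have *: "(grad (\<lambda>x. lagr \<phi> g x l) has_derivative (\<lambda>w. hess \<phi> zs *v w + hess_comb l w)) (at zs)"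
    by (rule has_derivative_transform_within_open[OF _ U(1,2)])
       (metis gderiv_lagr U(3,4) lagr_z_def)
  then have "grad (\<lambda>x. lagr \<phi> g x l) differentiable (at zs)" unfolding differentiable_def by blast
  from has_derivative_unique[OF hess_has_derivative[OF this] *]
  show ?thesis unfolding lagr_zz_def by metis
qed

text \<open>The accuracy \<open>e\<close> stays free because the primal error bound fixes it only
  after all its other constants; little-o remainders then suffice.\<close>

lemma first_order_expansion:
  assumes "0 < e"
  shows "\<exists>\<rho>>0. \<forall>z. norm (z - zs) \<le> \<rho> \<longrightarrow>
    norm (grad \<phi> z - grad \<phi> zs - hess \<phi> zs *v (z - zs)) \<le> e * norm (z - zs) \<and>
    (\<forall>i. norm (grad_con g i z - grad_con g i zs - hess (\<lambda>x. g x $ i) zs *v (z - zs)) \<le> e * norm (z - zs)) \<and>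
    (\<forall>i. \<bar>g z $ i - g zs $ i - grad_con g i zs \<bullet> (z - zs)\<bar> \<le> e * norm (z - zs))"
proof -
  obtain U where U: "zs \<in> U"
    "\<And>x i. x \<in> U \<Longrightarrow> GDERIV (\<lambda>z. g z $ i) x :> grad_con g i x"
    "(grad \<phi> has_derivative (\<lambda>h. hess \<phi> zs *v h)) (at zs)"
    "\<And>i. (grad_con g i has_derivative (\<lambda>h. hess (\<lambda>x. g x $ i) zs *v h)) (at zs)"
    by (rule smooth) blast
  obtain r1 where r1: "r1 > 0" "\<And>z. norm (z - zs) \<le> r1 \<Longrightarrow>
    norm (grad \<phi> z - grad \<phi> zs - hess \<phi> zs *v (z - zs)) \<le> e * norm (z - zs)"
    using frechet_remainder[OF U(3) assms] by blast
  have "\<forall>i. \<exists>d>0. \<forall>z. norm (z - zs) \<le> d \<longrightarrow>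
    norm (grad_con g i z - grad_con g i zs - hess (\<lambda>x. g x $ i) zs *v (z - zs)) \<le> e * norm (z - zs)"
    using frechet_remainder[OF U(4) assms] by blast
  from uniform_radius[OF this] obtain r2 where r2: "r2 > 0" "\<And>z i. norm (z - zs) \<le> r2 \<Longrightarrow>
    norm (grad_con g i z - grad_con g i zs - hess (\<lambda>x. g x $ i) zs *v (z - zs)) \<le> e * norm (z - zs)"
    by blast
  have "\<forall>i. \<exists>d>0. \<forall>z. norm (z - zs) \<le> d \<longrightarrow>
    \<bar>g z $ i - g zs $ i - (z - zs) \<bullet> grad_con g i zs\<bar> \<le> e * norm (z - zs)"
    using frechet_remainder[OF U(2)[OF U(1), unfolded gderiv_def] assms] by simp
  from uniform_radius[OF this] obtain r3 where r3: "r3 > 0" "\<And>z i. norm (z - zs) \<le> r3 \<Longrightarrow>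
    \<bar>g z $ i - g zs $ i - (z - zs) \<bullet> grad_con g i zs\<bar> \<le> e * norm (z - zs)"
    by blast
  show ?thesis
    using r1 r2 r3 by (intro exI[of _ "min r1 (min r2 r3)"]) (auto simp: inner_commute)
qed

lemma local_lipschitz:
  obtains K \<rho> where "K > 0" "\<rho> > 0"
    "\<And>z. norm (z - zs) \<le> \<rho> \<Longrightarrow> norm (grad \<phi> z - grad \<phi> zs) \<le> K * norm (z - zs)"
    "\<And>z u. norm (z - zs) \<le> \<rho> \<Longrightarrow> norm (grad_comb z u - grad_comb zs u) \<le> K * norm (z - zs) * norm u"
    "\<And>z i. norm (z - zs) \<le> \<rho> \<Longrightarrow> \<bar>g z $ i - g zs $ i\<bar> \<le> K * norm (z - zs)"
    "\<And>u. norm (grad_comb zs u) \<le> K * norm u"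
    "\<And>u w. norm (hess_comb u w) \<le> K * norm u * norm w"
proof -
  obtain U where U: "zs \<in> U"
    "\<And>x i. x \<in> U \<Longrightarrow> GDERIV (\<lambda>z. g z $ i) x :> grad_con g i x"
    "(grad \<phi> has_derivative (\<lambda>h. hess \<phi> zs *v h)) (at zs)"
    "\<And>i. (grad_con g i has_derivative (\<lambda>h. hess (\<lambda>x. g x $ i) zs *v h)) (at zs)"
    by (rule smooth) blast
  obtain K1 r1 where 1: "r1 > 0"
    "\<And>z. norm (z - zs) \<le> r1 \<Longrightarrow> norm (grad \<phi> z - grad \<phi> zs) \<le> K1 * norm (z - zs)"
    using has_derivative_imp_local_lipschitz[OF U(3)] by blast
  have "\<forall>i. \<exists>K. \<exists>d>0. \<forall>y. norm (y - zs) \<le> d \<longrightarrow> norm (grad_con g i y - grad_con g i zs) \<le> K * norm (y - zs)"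
    using has_derivative_imp_local_lipschitz[OF U(4)] by blast
  then obtain K2 where "\<forall>i. \<exists>d>0. \<forall>y. norm (y - zs) \<le> d \<longrightarrow>
      norm (grad_con g i y - grad_con g i zs) \<le> K2 i * norm (y - zs)" by metis
  from uniform_radius[OF this] obtain r2 where 2: "r2 > 0"
    "\<And>z i. norm (z - zs) \<le> r2 \<Longrightarrow> norm (grad_con g i z - grad_con g i zs) \<le> K2 i * norm (z - zs)" by blast
  have "\<forall>i. \<exists>K. \<exists>d>0. \<forall>y. norm (y - zs) \<le> d \<longrightarrow> norm (g y $ i - g zs $ i) \<le> K * norm (y - zs)"
    using has_derivative_imp_local_lipschitz[OF U(2)[OF U(1), unfolded gderiv_def]] by blast
  then obtain K3 where "\<forall>i. \<exists>d>0. \<forall>y. norm (y - zs) \<le> d \<longrightarrow>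
      norm (g y $ i - g zs $ i) \<le> K3 i * norm (y - zs)" by metis
  from uniform_radius[OF this] obtain r3 where 3: "r3 > 0"
    "\<And>z i. norm (z - zs) \<le> r3 \<Longrightarrow> \<bar>g z $ i - g zs $ i\<bar> \<le> K3 i * norm (z - zs)" by auto
  have "\<forall>i. \<exists>K. \<forall>w. norm (hess (\<lambda>x. g x $ i) zs *v w) \<le> norm w * K"
    using bounded_linear.bounded[OF matrix_vector_mul_bounded_linear] by blast
  then obtain K4 where 4: "\<And>i w. norm (hess (\<lambda>x. g x $ i) zs *v w) \<le> norm w * K4 i" by metis
  let ?m = "real CARD('m)"
  \<comment> \<open>A sum of absolute values dominates every individual constant at once; the
    summand 1 makes it positive.\<close>
  define c where "c = 1 + \<bar>K1\<bar> + (\<Sum>i\<in>UNIV. \<bar>K2 i\<bar> + \<bar>K3 i\<bar> + \<bar>K4 i\<bar> + norm (grad_con g i zs))"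
  have sum0: "0 \<le> (\<Sum>i\<in>UNIV. \<bar>K2 i\<bar> + \<bar>K3 i\<bar> + \<bar>K4 i\<bar> + norm (grad_con g i zs))"
    by (intro sum_nonneg) auto
  have mem: "\<bar>K2 i\<bar> + \<bar>K3 i\<bar> + \<bar>K4 i\<bar> + norm (grad_con g i zs) \<le> c" for i
    using member_le_sum[of i UNIV "\<lambda>i. \<bar>K2 i\<bar> + \<bar>K3 i\<bar> + \<bar>K4 i\<bar> + norm (grad_con g i zs)"]
    unfolding c_def by auto
  have c: "1 \<le> c" "K1 \<le> c" "K2 i \<le> c" "K3 i \<le> c" "K4 i \<le> c" "norm (grad_con g i zs) \<le> c" for i
    using sum0 mem[of i] norm_ge_zero[of "grad_con g i zs"] abs_ge_zero[of "K2 i"] abs_ge_zero[of "K3 i"]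
      abs_ge_zero[of "K4 i"] unfolding c_def by linarith+
  have m: "1 \<le> ?m" using zero_less_card_finite[where 'a='m] by simp
  have cm: "c \<le> ?m * c" using m c(1) by (simp add: mult_le_cancel_right1)
  have weaken: "x \<le> ?m * c * norm w" if "x \<le> k * norm w" "k \<le> c" for x k and w :: "real^'n"
    using that cm by (meson mult_right_mono norm_ge_zero order_trans)
  show ?thesis
  proof (rule that[of "?m * c" "min r1 (min r2 r3)"])
    show "?m * c > 0" using c(1) m by auto
    show "min r1 (min r2 r3) > 0" using 1 2 3 by auto
    fix z assume z: "norm (z - zs) \<le> min r1 (min r2 r3)"
    show "norm (grad \<phi> z - grad \<phi> zs) \<le> ?m * c * norm (z - zs)"
      using z 1(2) weaken c(2) by auto
    show "\<bar>g z $ i - g zs $ i\<bar> \<le> ?m * c * norm (z - zs)" for i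
      using z by (intro weaken[OF 3(2) c(4)]) auto
    have "norm (\<Sum>i\<in>UNIV. u$i *\<^sub>R (grad_con g i z - grad_con g i zs)) \<le> ?m * (c * norm (z - zs)) * norm u" for u
    proof (rule norm_sum_scaleR_le)
      show "norm (grad_con g i z - grad_con g i zs) \<le> c * norm (z - zs)" for i
        using z 2(2)[of z i] mult_right_mono[OF c(3)[of i], of "norm (z - zs)"] by simp
    qed
    then show "norm (grad_comb z u - grad_comb zs u) \<le> ?m * c * norm (z - zs) * norm u" for u
      unfolding grad_comb_def by (simp add: sum_subtractf[symmetric] scaleR_diff_right ac_simps)
  next
    show "norm (grad_comb zs u) \<le> ?m * c * norm u" for u
      unfolding grad_comb_def using c(6) by (rule norm_sum_scaleR_le)
    have "norm (hess (\<lambda>x. g x $ i) zs *v w) \<le> c * norm w" for i w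
      using 4[of i w] mult_right_mono[OF c(5)[of i], of "norm w"] by (simp add: ac_simps)
    then have "norm (hess_comb u w) \<le> ?m * (c * norm w) * norm u" for u w
      unfolding hess_comb_def by (rule norm_sum_scaleR_le)
    then show "norm (hess_comb u w) \<le> ?m * c * norm u * norm w" for u w
      by (simp add: ac_simps)
  qed
qed

section \<open>The multiplier set: compactness and error bounds\<close>

lemma M_nonempty: "M \<noteq> {}"
  using assumption_A unfolding assumption_A_def by blast

lemma g_zs_nonpos: "g zs $ i \<le> 0"
  using M_nonempty unfolding KKT_multipliers_def by (auto simp: less_eq_vec_def)

lemma g_zs_active: "i \<in> B \<Longrightarrow> g zs $ i = 0"
  unfolding active_def by simp

lemma g_zs_inactive: "i \<notin> B \<Longrightarrow> g zs $ i < 0"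
  using g_zs_nonpos[of i] unfolding active_def by simp

text \<open>All summands of the complementarity product have the same sign, so it vanishes only
  termwise. This turns the multiplier set into nonnegativity plus linear equations, the form that
  Hoffman's bound requires.\<close>

lemma M_iff: "l \<in> M \<longleftrightarrow> 0 \<le> l \<and> (\<forall>i. i \<notin> B \<longrightarrow> l$i = 0) \<and> res zs l = 0"
proof (cases "0 \<le> l")
  case True
  then have "0 \<le> l$i * - (g zs $ i)" for i
    using g_zs_nonpos[of i] by (intro mult_nonneg_nonneg) (auto simp: less_eq_vec_def)
  then have "(\<Sum>i\<in>UNIV. l$i * - (g zs $ i)) = 0 \<longleftrightarrow> (\<forall>i. l$i * - (g zs $ i) = 0)"
    by (simp add: sum_nonneg_eq_0_iff)
  also have "\<dots> \<longleftrightarrow> (\<forall>i. i \<notin> B \<longrightarrow> l$i = 0)" unfolding active_def by auto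
  finally have "l \<bullet> g zs = 0 \<longleftrightarrow> (\<forall>i. i \<notin> B \<longrightarrow> l$i = 0)"
    unfolding inner_vec_def by (simp add: sum_negf)
  then show ?thesis
    using True g_zs_nonpos unfolding KKT_multipliers_def by (auto simp: lagr_z_at less_eq_vec_def)
qed (auto simp: KKT_multipliers_def)

lemma M_D:
  assumes "l \<in> M"
  shows "0 \<le> l$i" "i \<notin> B \<Longrightarrow> l$i = 0" "i \<notin> Bp \<Longrightarrow> l$i = 0" "res zs l = 0"
  using assms[unfolded M_iff] assms unfolding active_plus_def
  by (auto simp: less_eq_vec_def) (metis less_eq_real_def)

lemma Bp_subset: "Bp \<subseteq> B" and B0_eq: "B0 = B - Bp"
  unfolding active_plus_def active_zero_def by auto

text \<open>Pairing stationarity with the MFCQ direction \<open>y\<close> writes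
  \<open>grad \<phi> zs \<bullet> y\<close> as a sum of nonnegative terms in which every active
  multiplier has a positive coefficient, which bounds each of them.\<close>

lemma M_bounded: "\<exists>R>0. \<forall>l\<in>M. norm l \<le> R"
proof -
  obtain y where y: "\<And>i. i \<in> B \<Longrightarrow> grad_con g i zs \<bullet> y < 0"
    using assumption_A unfolding assumption_A_def MFCQ_def by blast
  let ?r = "\<lambda>i. (grad \<phi> zs \<bullet> y) / - (grad_con g i zs \<bullet> y)"
  have "norm l \<le> (\<Sum>i\<in>UNIV. \<bar>?r i\<bar>)" if l: "l \<in> M" for l
  proof -
    have nonneg: "0 \<le> l$i * - (grad_con g i zs \<bullet> y)" for i
      using M_D(1,2)[OF l, of i] y[of i] by (cases "i \<in> B") (auto simp: mult_nonneg_nonpos less_imp_le)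
    have "(grad \<phi> zs + grad_comb zs l) \<bullet> y = 0" using M_D(4)[OF l] unfolding res_def by simp
    then have sum: "(\<Sum>i\<in>UNIV. l$i * - (grad_con g i zs \<bullet> y)) = grad \<phi> zs \<bullet> y"
      by (simp add: inner_add_left grad_comb_inner sum_negf)
    have "\<bar>l$i\<bar> \<le> \<bar>?r i\<bar>" for i
    proof (cases "i \<in> B")
      case True
      have "l$i * - (grad_con g i zs \<bullet> y) \<le> grad \<phi> zs \<bullet> y"
        using member_le_sum[of i UNIV "\<lambda>i. l$i * - (grad_con g i zs \<bullet> y)"] nonneg sum by simp
      then have "l$i \<le> ?r i" using y[OF True] by (subst pos_le_divide_eq) auto
      then show ?thesis using M_D(1)[OF l, of i] by linarith
    qed (simp add: M_D(2)[OF l])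
    then show ?thesis by (intro order_trans[OF norm_le_l1_cart] sum_mono)
  qed
  moreover have "0 \<le> (\<Sum>i\<in>UNIV. \<bar>?r i\<bar>)" by (simp add: sum_nonneg)
  ultimately show ?thesis by (intro exI[of _ "(\<Sum>i\<in>UNIV. \<bar>?r i\<bar>) + 1"]) force
qed

lemma continuous_on_res: "continuous_on A (res z)"
  unfolding res_def grad_comb_def by (intro continuous_intros)

lemma M_compact: "compact M"
proof -
  have "M = (\<Inter>i. {l. 0 \<le> l$i}) \<inter> (\<Inter>i\<in>-B. {l. l$i = 0}) \<inter> {l. res zs l = 0}"
    using M_iff by (auto simp: less_eq_vec_def)
  then have "closed M"
    by (simp only:) (intro closed_Int closed_INT ballI closed_Collect_le closed_Collect_eq continuous_intros continuous_on_res)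
  moreover have "bounded M" using M_bounded unfolding bounded_iff by blast
  ultimately show ?thesis by (simp add: compact_eq_bounded_closed)
qed

text \<open>The support condition is made a second component of the linear map \<open>f\<close>.
  That component vanishes for the \<open>u\<close> considered, so Hoffman's residual is just the
  stationarity residual.\<close>

lemma M_error_bound:
  "\<exists>C>0. \<forall>u. 0 \<le> u \<longrightarrow> (\<forall>i. i \<notin> B \<longrightarrow> u$i = 0) \<longrightarrow> (\<exists>l\<in>M. norm (u - l) \<le> C * norm (res zs u))"
proof -
  define f where "f u = (grad_comb zs u, (\<chi> i. if i \<in> B then 0 else u$i) :: real^'m)" for u
  have "linear f" unfolding f_def
    by (intro linearI)
       (auto simp: linear_add[OF linear_grad_comb] linear_cmul[OF linear_grad_comb] vec_eq_iff)
  have f_iff: "f u = (- grad \<phi> zs, 0) \<longleftrightarrow> (\<forall>i. i \<notin> B \<longrightarrow> u$i = 0) \<and> res zs u = 0" for u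
    unfolding f_def res_def by (auto simp: vec_eq_iff) (simp_all add: add_eq_0_iff)
  obtain l0 where l0: "l0 \<in> M" using M_nonempty by blast
  obtain C where C: "C > 0" "\<And>u. 0 \<le> u \<Longrightarrow>
      \<exists>l\<ge>0. f l = (- grad \<phi> zs, 0) \<and> norm (u - l) \<le> C * norm (f u - (- grad \<phi> zs, 0))"
    using hoffman_bound[OF \<open>linear f\<close>, of l0 "(- grad \<phi> zs, 0)"] l0[unfolded M_iff] f_iff by blast
  have "norm (f u - (- grad \<phi> zs, 0)) = norm (res zs u)" if "\<forall>i. i \<notin> B \<longrightarrow> u$i = 0" for u
  proof -
    have "(\<chi> i. if i \<in> B then 0 else u$i) = (0 :: real^'m)" using that by (auto simp: vec_eq_iff)
    then show ?thesis unfolding f_def res_def by (simp add: norm_Pair add.commute)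
  qed
  then show ?thesis using C M_iff f_iff by (intro exI[of _ C]) metis
qed

text \<open>Passing from \<open>res zs\<close> to \<open>res z\<close> costs a multiple of
  \<open>norm (z - zs) * (1 + norm u)\<close>, and \<open>u\<close> is not bounded in advance. But
  \<open>norm u \<le> R + d\<close> with \<open>d\<close> the very distance being estimated, so for
  small \<open>norm (z - zs)\<close> this share of \<open>d\<close> moves to the left-hand
  side.\<close>

lemma M_local_error_bound:
  "\<exists>C>0. \<exists>\<rho>>0. \<forall>z u. norm (z - zs) \<le> \<rho> \<longrightarrow> 0 \<le> u \<longrightarrow> (\<forall>i. i \<notin> B \<longrightarrow> u$i = 0) \<longrightarrow>
     (\<exists>l\<in>M. norm (u - l) \<le> C * (norm (res z u) + norm (z - zs)))"
proof -
  obtain K \<rho> where K: "K > 0" "\<rho> > 0"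
    "\<And>z. norm (z - zs) \<le> \<rho> \<Longrightarrow> norm (grad \<phi> z - grad \<phi> zs) \<le> K * norm (z - zs)"
    "\<And>z u. norm (z - zs) \<le> \<rho> \<Longrightarrow> norm (grad_comb z u - grad_comb zs u) \<le> K * norm (z - zs) * norm u"
    by (rule local_lipschitz) blast
  obtain R where R: "R > 0" "\<And>l. l \<in> M \<Longrightarrow> norm l \<le> R" using M_bounded by blast
  obtain C where C: "C > 0" "\<And>u. 0 \<le> u \<Longrightarrow> (\<forall>i. i \<notin> B \<longrightarrow> u$i = 0) \<Longrightarrow>
      \<exists>l\<in>M. norm (u - l) \<le> C * norm (res zs u)" using M_error_bound by blast
  \<comment> \<open>The radius keeps the coefficient of the distance on the right at most 1/2;
    absorbing it accounts for the factor 2 in \<open>D\<close>.\<close>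
  define r where "r = min \<rho> (1 / (2 * C * K))"
  define D where "D = 2 * C * (1 + K * (1 + R))"
  have "\<exists>l\<in>M. norm (u - l) \<le> D * (norm (res z u) + norm (z - zs))"
    if z: "norm (z - zs) \<le> r" and u: "0 \<le> u" "\<forall>i. i \<notin> B \<longrightarrow> u$i = 0" for z u
  proof -
    define s where "s = norm (z - zs)"
    define x where "x = norm (res z u)"
    obtain l where l: "l \<in> M" "norm (u - l) \<le> C * norm (res zs u)" using C(2) u by blast
    define d where "d = norm (u - l)"
    have s: "s \<le> \<rho>" "s * (2 * C * K) \<le> 1" "0 \<le> s"
      using z K(1) C(1) unfolding r_def s_def by (auto simp: pos_le_divide_eq)
    have "norm u \<le> R + d" using norm_triangle_sub[of u l] R(2)[OF l(1)] unfolding d_def by linarith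
    then have *: "K * s * norm u \<le> K * s * (R + d)" using K(1) s by (intro mult_left_mono) auto
    have "res zs u = res z u - (grad \<phi> z - grad \<phi> zs) - (grad_comb z u - grad_comb zs u)"
      unfolding res_def by simp
    then have "norm (res zs u) \<le> x + K * s + K * s * norm u"
      using norm_triangle_ineq4[of "res z u - (grad \<phi> z - grad \<phi> zs)" "grad_comb z u - grad_comb zs u"]
        norm_triangle_ineq4[of "res z u" "grad \<phi> z - grad \<phi> zs"] K(3)[of z] K(4)[of z u] s(1)
      unfolding s_def x_def by simp
    then have "C * norm (res zs u) \<le> C * (x + K * s + K * s * (R + d))"
      using * C(1) by (intro mult_left_mono) auto
    then have "d \<le> C * x + C * K * s * (1 + R) + (C * K * s) * d"
      using l(2) unfolding d_def by (simp add: algebra_simps)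
    moreover have "(C * K * s) * d \<le> 1/2 * d"
      using s(2) unfolding d_def by (intro mult_right_mono) (auto simp: algebra_simps)
    ultimately have "d \<le> 2 * C * x + 2 * C * K * s * (1 + R)" by (simp add: algebra_simps)
    also have "\<dots> \<le> D * (x + s)"
      unfolding D_def x_def using C(1) K(1) R(1) s(3) by (simp add: algebra_simps)
    finally show ?thesis using l(1) unfolding d_def x_def s_def by blast
  qed
  moreover have "r > 0" using K(1,2) C(1) unfolding r_def by simp
  moreover have "D > 0" using K(1) C(1) R(1) unfolding D_def by (intro mult_pos_pos add_pos_pos) auto
  ultimately show ?thesis by blast
qed

text \<open>Compactness: on unit vectors whose curvature is at most half the given constant, for
  some multiplier, the violation of criticality is positive, hence bounded away from 0. Directions
  that violate criticality less must therefore have the larger curvature, uniformly over the compact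
  multiplier set.\<close>

lemma approx_critical_coercive:
  "\<exists>\<alpha>>0. \<exists>\<kappa>>0. \<forall>l\<in>M. \<forall>w. (\<forall>i\<in>Bp. \<bar>grad_con g i zs \<bullet> w\<bar> \<le> \<kappa> * norm w) \<longrightarrow>
     (\<forall>i\<in>B. grad_con g i zs \<bullet> w \<le> \<kappa> * norm w) \<longrightarrow>
     \<alpha> * (norm w)\<^sup>2 \<le> w \<bullet> (hess \<phi> zs *v w + hess_comb l w)"
proof -
  obtain \<alpha> where \<alpha>: "\<alpha> > 0"
    "\<And>l w. l \<in> M \<Longrightarrow> \<forall>i\<in>Bp. grad_con g i zs \<bullet> w = 0 \<Longrightarrow> \<forall>i\<in>B0. grad_con g i zs \<bullet> w \<le> 0 \<Longrightarrow>
       \<alpha> * (norm w)\<^sup>2 \<le> w \<bullet> (hess \<phi> zs *v w + hess_comb l w)"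
    using assumption_A unfolding assumption_A_def second_order_sufficient_def lagr_zz_eq by blast
  \<comment> \<open>Total violation of the conditions defining the critical cone; it vanishes
    exactly on that cone.\<close>
  define F where "F w = (\<Sum>i\<in>Bp. \<bar>grad_con g i zs \<bullet> w\<bar>) + (\<Sum>i\<in>B0. max 0 (grad_con g i zs \<bullet> w))"
    for w
  define Q where "Q p = snd p \<bullet> (hess \<phi> zs *v snd p + hess_comb (fst p) (snd p))"
    for p :: "(real^'m) \<times> (real^'n)"
  let ?T = "M \<times> sphere 0 1 \<inter> {p. Q p \<le> \<alpha>/2}"
  have "continuous_on UNIV Q" unfolding Q_def hess_comb_def
    by (intro continuous_intros bounded_linear.continuous_on[OF matrix_vector_mul_bounded_linear])
  then have T: "compact ?T"
    by (intro compact_Int_closed compact_Times M_compact compact_sphere closed_Collect_le continuous_intros)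
  have Q_scale: "Q (l, c *\<^sub>R w) = c\<^sup>2 * Q (l, w)" for l c w
    unfolding Q_def hess_comb_def
    by (simp add: power2_eq_square matrix_vector_mult_scaleR algebra_simps scaleR_sum_right
        inner_sum_right inner_add_right sum_distrib_left)
  have F_nonneg: "0 \<le> F w" for w unfolding F_def by (intro add_nonneg_nonneg sum_nonneg) auto
  have F_pos: "0 < F (snd p)" if "p \<in> ?T" for p
  proof (rule ccontr)
    assume "\<not> 0 < F (snd p)"
    then have "F (snd p) = 0" using F_nonneg[of "snd p"] by simp
    then have "(\<Sum>i\<in>Bp. \<bar>grad_con g i zs \<bullet> snd p\<bar>) = 0" "(\<Sum>i\<in>B0. max 0 (grad_con g i zs \<bullet> snd p)) = 0"
      unfolding F_def by (simp_all add: add_nonneg_eq_0_iff sum_nonneg)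
    then have "\<forall>i\<in>Bp. grad_con g i zs \<bullet> snd p = 0" "\<forall>i\<in>B0. max 0 (grad_con g i zs \<bullet> snd p) = 0"
      by (simp_all add: sum_nonneg_eq_0_iff)
    then have "\<forall>i\<in>Bp. grad_con g i zs \<bullet> snd p = 0" "\<forall>i\<in>B0. grad_con g i zs \<bullet> snd p \<le> 0"
      by (auto simp: max_def split: if_splits)
    then have "\<alpha> * (norm (snd p))\<^sup>2 \<le> Q p" unfolding Q_def using \<alpha>(2)[of "fst p" "snd p"] that by auto
    then show False using that \<alpha>(1) by auto
  qed
  have "\<exists>f>0. \<forall>p\<in>?T. f \<le> F (snd p)"
  proof (cases "?T = {}")
    case True
    show ?thesis unfolding True using zero_less_one by blast
  next
    case False
    have "continuous_on ?T (\<lambda>p. F (snd p))" unfolding F_def by (intro continuous_intros)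
    from continuous_attains_inf[OF T False this] show ?thesis using F_pos by blast
  qed
  then obtain f where f: "f > 0" "\<And>p. p \<in> ?T \<Longrightarrow> f \<le> F (snd p)" by blast
  \<comment> \<open>A unit vector that is critical up to \<kappa> has total violation at most
    \<open>2 * CARD('m) * \<kappa>\<close>, and the 3 makes this smaller than
    \<open>f\<close>.\<close>
  define \<kappa> where "\<kappa> = f / (3 * CARD('m))"
  have \<kappa>: "\<kappa> > 0" "2 * CARD('m) * \<kappa> < f"
    using f(1) zero_less_card_finite[where 'a='m] unfolding \<kappa>_def by (auto simp: field_simps)
  have "\<alpha>/2 * (norm w)\<^sup>2 \<le> Q (l, w)"
    if l: "l \<in> M" and w: "\<forall>i\<in>Bp. \<bar>grad_con g i zs \<bullet> w\<bar> \<le> \<kappa> * norm w"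
      "\<forall>i\<in>B. grad_con g i zs \<bullet> w \<le> \<kappa> * norm w" for l w
  proof (cases "w = 0")
    case False
    define u where "u = w /\<^sub>R norm w"
    have u: "norm u = 1" "w = norm w *\<^sub>R u" unfolding u_def using False by auto
    have inner_u: "grad_con g i zs \<bullet> w = norm w * (grad_con g i zs \<bullet> u)" for i
      by (subst u(2)) simp
    have "\<bar>grad_con g i zs \<bullet> u\<bar> \<le> \<kappa>" if "i \<in> Bp" for i
      using w(1) that False unfolding inner_u by (simp add: abs_mult)
    moreover have "max 0 (grad_con g i zs \<bullet> u) \<le> \<kappa>" if "i \<in> B0" for i
      using w(2) that False \<kappa>(1) unfolding inner_u B0_eq by simp
    ultimately have "F u \<le> card Bp * \<kappa> + card B0 * \<kappa>"
      unfolding F_def by (intro add_mono sum_bounded_above)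
    also have "\<dots> \<le> CARD('m) * \<kappa> + CARD('m) * \<kappa>"
      using \<kappa>(1) by (intro add_mono mult_right_mono) (auto intro: card_mono)
    finally have "F u < f" using \<kappa>(2) by (simp add: ac_simps)
    then have "(l, u) \<notin> ?T" using f(2)[of "(l, u)"] by auto
    then have "\<alpha>/2 \<le> Q (l, u)" using l u(1) by auto
    then have "(norm w)\<^sup>2 * (\<alpha>/2) \<le> (norm w)\<^sup>2 * Q (l, u)" by (intro mult_left_mono) auto
    also have "\<dots> = Q (l, w)" using Q_scale[of l "norm w" u] u(2) by simp
    finally show ?thesis by (simp add: mult.commute)
  qed (simp add: Q_def)
  then show ?thesis unfolding Q_def using \<alpha>(1) \<kappa>(1)
    by (intro exI[of _ "\<alpha>/2"] conjI exI[of _ \<kappa>]) auto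
qed

section \<open>Uniform gaps and the complementarity residual\<close>

lemma inactive_gap: "\<exists>\<gamma>>0. \<forall>i. i \<notin> B \<longrightarrow> g zs $ i \<le> - \<gamma>"
proof -
  \<comment> \<open>The element 1 keeps the minimum meaningful when every constraint is
    active.\<close>
  define X where "X = insert 1 ((\<lambda>i. - (g zs $ i)) ` (-B))"
  have "Min X > 0" unfolding X_def using g_zs_inactive by (subst Min_gr_iff) auto
  moreover have "g zs $ i \<le> - Min X" if "i \<notin> B" for i
  proof -
    have "Min X \<le> - (g zs $ i)" unfolding X_def using that by (intro Min_le) auto
    then show ?thesis by linarith
  qed
  ultimately show ?thesis by blast
qed

text \<open>The multiplier may depend on the index; only the lower bound has to be uniform, both for
  criticality of \<open>z - zs\<close> and for progress of the loop.\<close>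

lemma Bp_multiplier: "\<exists>\<epsilon>>0. \<forall>i\<in>Bp. \<exists>l\<in>M. \<epsilon> \<le> l$i"
proof -
  have "\<forall>i\<in>Bp. \<exists>l\<in>M. 0 < l$i" unfolding active_plus_def by auto
  then obtain L where L: "\<And>i. i \<in> Bp \<Longrightarrow> L i \<in> M \<and> 0 < L i $ i" by metis
  let ?X = "insert 1 ((\<lambda>i. L i $ i) ` Bp)"
  have "Min ?X > 0" using L by (subst Min_gr_iff) auto
  moreover have "Min ?X \<le> L i $ i" if "i \<in> Bp" for i using that by (intro Min_le) auto
  ultimately show ?thesis using L by blast
qed

definition slack :: "real^'n \<Rightarrow> real^'m \<Rightarrow> real^'m" where
  "slack z l = (\<chi> i. min (l$i) (- (g z $ i)))"

lemma eta_bounds: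
  assumes "lagr_z \<phi> g z l = res z l"
  shows "norm (res z l) \<le> eta \<phi> g z l" "norm (slack z l) \<le> eta \<phi> g z l"
    "eta \<phi> g z l \<le> norm (res z l) + norm (slack z l)"
  using norm_Pair_le[of "res z l" "slack z l"]
  unfolding eta_def assms slack_def
  by (simp_all add: norm_Pair real_le_rsqrt)

text \<open>Near the KKT set an inactive multiplier is smaller than the constraint's distance from
  activity, so there the slack is the multiplier itself and the shift makes it exactly 0. Thus
  \<open>l - slack z l\<close> is nonnegative with support in \<open>B\<close>, and the error bound
  for multipliers applies to it.\<close>

lemma shifted_multiplier:
  "\<exists>D>0. \<exists>\<delta>>0. \<forall>z l l0. norm (z - zs) \<le> \<delta> \<longrightarrow> l0 \<in> M \<longrightarrow> norm (l - l0) \<le> \<delta> \<longrightarrow>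
     (\<forall>i. i \<notin> B \<longrightarrow> (l - slack z l)$i = 0) \<and>
     (\<exists>ls\<in>M. norm (l - slack z l - ls) \<le> D * (eta \<phi> g z l + norm (z - zs)))"
proof -
  obtain K \<rho>1 where K: "K > 0" "\<rho>1 > 0"
    "\<And>z u. norm (z - zs) \<le> \<rho>1 \<Longrightarrow> norm (grad_comb z u - grad_comb zs u) \<le> K * norm (z - zs) * norm u"
    "\<And>z i. norm (z - zs) \<le> \<rho>1 \<Longrightarrow> \<bar>g z $ i - g zs $ i\<bar> \<le> K * norm (z - zs)"
    "\<And>u. norm (grad_comb zs u) \<le> K * norm u"
    by (rule local_lipschitz) blast
  obtain C \<rho>2 where C: "C > 0" "\<rho>2 > 0" "\<And>z u. norm (z - zs) \<le> \<rho>2 \<Longrightarrow> 0 \<le> u \<Longrightarrow>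
      (\<forall>i. i \<notin> B \<longrightarrow> u$i = 0) \<Longrightarrow> \<exists>l\<in>M. norm (u - l) \<le> C * (norm (res z u) + norm (z - zs))"
    using M_local_error_bound by blast
  obtain \<rho>3 where \<rho>3: "\<rho>3 > 0" "\<And>z l. norm (z - zs) \<le> \<rho>3 \<Longrightarrow> lagr_z \<phi> g z l = res z l"
    using lagr_z_eq by blast
  obtain \<gamma> where \<gamma>: "\<gamma> > 0" "\<And>i. i \<notin> B \<Longrightarrow> g zs $ i \<le> - \<gamma>" using inactive_gap by blast
  define D where "D = C * (1 + 2 * K)"
  have "D > 0" unfolding D_def using C(1) K(1) by simp
  \<comment> \<open>The last entry gives \<open>l$i \<le> \<delta> \<le> \<gamma> - K * \<delta>
    \<le> - (g z $ i)\<close> at inactive indices.\<close>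
  define \<delta> where "\<delta> = Min {1, \<rho>1, \<rho>2, \<rho>3, \<gamma> / (1 + K)}"
  have "\<delta> > 0" unfolding \<delta>_def
    using K(1,2) C(2) \<rho>3(1) \<gamma>(1) by (subst Min_gr_iff) auto
  moreover have "\<delta> \<le> 1" "\<delta> \<le> \<rho>1" "\<delta> \<le> \<rho>2" "\<delta> \<le> \<rho>3" "\<delta> \<le> \<gamma> / (1 + K)"
    unfolding \<delta>_def by (intro Min_le; simp)+
  moreover from this have "\<delta> + K * \<delta> \<le> \<gamma>"
    using K(1) by (simp add: pos_le_divide_eq algebra_simps)
  ultimately have \<delta>: "\<delta> > 0" "\<delta> \<le> 1" "\<delta> \<le> \<rho>1" "\<delta> \<le> \<rho>2" "\<delta> \<le> \<rho>3" "\<delta> + K * \<delta> \<le> \<gamma>" by blast+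
  have "(\<forall>i. i \<notin> B \<longrightarrow> (l - slack z l)$i = 0) \<and>
     (\<exists>ls\<in>M. norm (l - slack z l - ls) \<le> D * (eta \<phi> g z l + norm (z - zs)))"
    if z: "norm (z - zs) \<le> \<delta>" and l0: "l0 \<in> M" "norm (l - l0) \<le> \<delta>" for z l l0
  proof -
    define n r rr where "n = norm (z - zs)" and "r = eta \<phi> g z l" and "rr = slack z l"
    have n: "0 \<le> n" "n \<le> \<delta>" using z unfolding n_def by auto
    have zb: "norm (z - zs) \<le> \<rho>1" "norm (z - zs) \<le> \<rho>2" "norm (z - zs) \<le> \<rho>3" using z \<delta> by auto
    have bounds: "norm (res z l) \<le> r" "norm rr \<le> r"
      using eta_bounds[OF \<rho>3(2)[OF zb(3)]] unfolding r_def rr_def by auto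
    have inactive: "(l - rr)$i = 0" if "i \<notin> B" for i
    proof -
      have "l$i \<le> \<delta>" using component_le_norm_cart[of "l - l0" i] l0(2) M_D(2)[OF l0(1) that] by simp
      moreover have "g z $ i \<le> - \<gamma> + K * n"
        using K(4)[OF zb(1), of i] \<gamma>(2)[OF that] unfolding n_def by linarith
      moreover have "K * n \<le> K * \<delta>" using n(2) K(1) by simp
      ultimately have "l$i \<le> - (g z $ i)" using \<delta>(6) by linarith
      then show ?thesis unfolding rr_def slack_def by simp
    qed
    have Kn: "K * n \<le> K" using K(1) n \<delta>(2) mult_left_mono[of n 1 K] by simp
    have gc_rr: "norm (grad_comb z rr) \<le> 2 * K * r"
    proof -
      have "norm (grad_comb z rr) \<le> K * norm rr + K * n * norm rr"
        using K(3)[OF zb(1), of rr] K(5)[of rr] norm_triangle_sub[of "grad_comb z rr" "grad_comb zs rr"]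
        unfolding n_def by linarith
      also have "\<dots> \<le> K * r + K * r"
        using bounds(2) K(1) Kn n by (intro add_mono mult_mono) auto
      finally show ?thesis by simp
    qed
    have "res z (l - rr) = res z l - grad_comb z rr"
      unfolding res_def by (simp add: linear_diff[OF linear_grad_comb])
    then have "norm (res z (l - rr)) \<le> r + 2 * K * r"
      using norm_triangle_ineq4[of "res z l" "grad_comb z rr"] bounds(1) gc_rr by simp
    then have "norm (res z (l - rr)) + n \<le> (1 + 2 * K) * (r + n)"
      using mult_nonneg_nonneg[OF less_imp_le[OF K(1)] n(1)] by (simp add: algebra_simps)
    then have le: "C * (norm (res z (l - rr)) + n) \<le> D * (r + n)"
      unfolding D_def mult.assoc using C(1) by (intro mult_left_mono) auto
    have "0 \<le> l - rr"
      unfolding rr_def slack_def by (simp add: less_eq_vec_def)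
    then obtain ls where ls: "ls \<in> M" "norm (l - rr - ls) \<le> C * (norm (res z (l - rr)) + n)"
      using C(3)[OF zb(2), of "l - rr"] inactive unfolding n_def by blast
    then have "norm (l - rr - ls) \<le> D * (r + n)" using le by linarith
    then show ?thesis using inactive ls(1) unfolding n_def r_def rr_def by blast
  qed
  then show ?thesis using \<open>D > 0\<close> \<delta>(1) by blast
qed

text \<open>
  The pair \<open>(z, l - r)\<close> with \<open>r = min l (- g z)\<close> satisfies exactly the complementarity conditions
  for the constraints \<open>g + r \<le> 0\<close>, which makes it comparable with a nearby multiplier at \<open>zs\<close>.
\<close>

lemma primal_error_bound:
  "\<exists>\<kappa>>0. \<exists>\<delta>>0. \<forall>z l l0. norm (z - zs) \<le> \<delta> \<longrightarrow> l0 \<in> M \<longrightarrow> norm (l - l0) \<le> \<delta> \<longrightarrow>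
     \<kappa> * norm (z - zs) \<le> eta \<phi> g z l"
proof -
  obtain K where K: "K > 0"
    "\<And>u. norm (grad_comb zs u) \<le> K * norm u"
    "\<And>u w. norm (hess_comb u w) \<le> K * norm u * norm w"
    by (rule local_lipschitz) blast
  obtain R where R: "R > 0" "\<And>l. l \<in> M \<Longrightarrow> norm l \<le> R" using M_bounded by blast
  obtain D0 \<rho>2 where D0: "D0 > 0" "\<rho>2 > 0"
    "\<And>z l l0. norm (z - zs) \<le> \<rho>2 \<Longrightarrow> l0 \<in> M \<Longrightarrow> norm (l - l0) \<le> \<rho>2 \<Longrightarrow>
      (\<forall>i. i \<notin> B \<longrightarrow> (l - slack z l)$i = 0) \<and>
      (\<exists>ls\<in>M. norm (l - slack z l - ls) \<le> D0 * (eta \<phi> g z l + norm (z - zs)))"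
    using shifted_multiplier by blast
  obtain \<rho>3 where \<rho>3: "\<rho>3 > 0" "\<And>z l. norm (z - zs) \<le> \<rho>3 \<Longrightarrow> lagr_z \<phi> g z l = res z l"
    using lagr_z_eq by blast
  obtain \<epsilon> where \<epsilon>: "\<epsilon> > 0" "\<And>i. i \<in> Bp \<Longrightarrow> \<exists>l\<in>M. \<epsilon> \<le> l$i" using Bp_multiplier by blast
  obtain \<alpha> \<kappa>0 where \<alpha>: "\<alpha> > 0" "\<kappa>0 > 0"
    "\<And>l w. l \<in> M \<Longrightarrow> \<forall>i\<in>Bp. \<bar>grad_con g i zs \<bullet> w\<bar> \<le> \<kappa>0 * norm w \<Longrightarrow>
      \<forall>i\<in>B. grad_con g i zs \<bullet> w \<le> \<kappa>0 * norm w \<Longrightarrow>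
      \<alpha> * (norm w)\<^sup>2 \<le> w \<bullet> (hess \<phi> zs *v w + hess_comb l w)"
    using approx_critical_coercive by blast
  define m where "m = real CARD('m)"
  have m: "m > 0" unfolding m_def by simp
  define D where "D = 2 * D0"
  \<comment> \<open>\<open>P\<close> collects the coefficients of \<kappa> n in the lower bound for
    strongly active gradients, \<open>E\<close> those of \<kappa> n^2 in the curvature estimate,
    with n the norm of \<open>z - zs\<close>. The 2 in \<open>D\<close> comes from eta \<le>
    n.\<close>
  define P where "P = 2 * m * (R + D) + D * K + 2 * m * R"
  define E where "E = 2 + m * (R + 1) + K * (D + 1) + K + 2 * m * D"
  have pos: "D > 0" "P > 0" "E > 0"
  proof -
    show D: "D > 0" unfolding D_def using D0(1) by simp
    show "P > 0" "E > 0" unfolding P_def E_def using D K(1) R(1) m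
      by (intro add_pos_pos mult_pos_pos; simp)+
  qed
  \<comment> \<open>The three bounds give, in turn, eta \<le> n, criticality of
    \<open>z - zs\<close> within \<kappa>0, and curvature at most half of the coercivity
    constant.\<close>
  define \<kappa> where "\<kappa> = min 1 (min (\<kappa>0 / (2 + P / \<epsilon>)) (\<alpha> / (2 * E)))"
  have P\<epsilon>: "P / \<epsilon> > 0" using pos \<epsilon>(1) by simp
  have "\<kappa> \<le> \<kappa>0 / (2 + P / \<epsilon>)" "\<kappa> \<le> \<alpha> / (2 * E)" unfolding \<kappa>_def by auto
  then have \<kappa>: "\<kappa> > 0" "\<kappa> \<le> 1" "(2 + P / \<epsilon>) * \<kappa> \<le> \<kappa>0" "\<kappa> * E < \<alpha>"
    using \<alpha>(1,2) pos P\<epsilon> unfolding \<kappa>_def by (auto simp: pos_le_divide_eq ac_simps intro: divide_pos_pos)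
  have \<kappa>2: "2 * \<kappa> \<le> \<kappa>0" "P / \<epsilon> * \<kappa> \<le> \<kappa>0"
    using \<kappa>(1,3) P\<epsilon> mult_pos_pos[OF P\<epsilon> \<kappa>(1)] by (simp_all add: distrib_right)
  obtain \<rho>4 where \<rho>4: "\<rho>4 > 0"
    "\<And>z. norm (z - zs) \<le> \<rho>4 \<Longrightarrow>
      norm (grad \<phi> z - grad \<phi> zs - hess \<phi> zs *v (z - zs)) \<le> \<kappa> * norm (z - zs)"
    "\<And>z i. norm (z - zs) \<le> \<rho>4 \<Longrightarrow>
      norm (grad_con g i z - grad_con g i zs - hess (\<lambda>x. g x $ i) zs *v (z - zs)) \<le> \<kappa> * norm (z - zs)"
    "\<And>z i. norm (z - zs) \<le> \<rho>4 \<Longrightarrow>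
      \<bar>g z $ i - g zs $ i - grad_con g i zs \<bullet> (z - zs)\<bar> \<le> \<kappa> * norm (z - zs)"
    using first_order_expansion[OF \<kappa>(1)] by blast
  \<comment> \<open>Including \<kappa> here gives n \<le> \<kappa>, which turns products of two
    quantities of order n into order \<kappa> n.\<close>
  define \<delta> where "\<delta> = Min {1, \<kappa>, \<rho>2, \<rho>3, \<rho>4}"
  have "\<delta> > 0" unfolding \<delta>_def
    using \<kappa>(1) D0(2) \<rho>3(1) \<rho>4(1) by (subst Min_gr_iff) auto
  moreover have "\<delta> \<le> 1" "\<delta> \<le> \<kappa>" "\<delta> \<le> \<rho>2" "\<delta> \<le> \<rho>3" "\<delta> \<le> \<rho>4"
    unfolding \<delta>_def by (intro Min_le; simp)+
  ultimately have \<delta>: "\<delta> > 0" "\<delta> \<le> 1" "\<delta> \<le> \<kappa>" "\<delta> \<le> \<rho>2" "\<delta> \<le> \<rho>3" "\<delta> \<le> \<rho>4" by blast+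
  have "\<kappa> * norm (z - zs) \<le> eta \<phi> g z l"
    if z: "norm (z - zs) \<le> \<delta>" and l0: "l0 \<in> M" "norm (l - l0) \<le> \<delta>" for z l l0
  proof (rule ccontr)
    define s n r rr \<mu> where "s = z - zs" and "n = norm s" and "r = eta \<phi> g z l"
      and "rr = slack z l" and "\<mu> = l - slack z l"
    assume "\<not> \<kappa> * norm (z - zs) \<le> eta \<phi> g z l"
    then have r\<kappa>: "r \<le> \<kappa> * n" and "r < \<kappa> * n" unfolding r_def n_def s_def by auto
    have r0: "0 \<le> r" unfolding r_def eta_def by simp
    then have n: "0 < n" using \<open>r < \<kappa> * n\<close> \<kappa>(1) by (metis le_less_trans zero_less_mult_pos)
    have n\<delta>: "n \<le> \<delta>" using z unfolding n_def s_def .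
    then have n1: "n \<le> 1" "n \<le> \<kappa>" using \<delta> by auto
    have rn: "r \<le> n" using order_trans[OF r\<kappa> mult_right_mono[OF \<kappa>(2), of n]] n by simp
    have zb: "norm (z - zs) \<le> \<rho>2" "norm (z - zs) \<le> \<rho>3" "norm (z - zs) \<le> \<rho>4" "norm (l - l0) \<le> \<rho>2"
      using z l0(2) \<delta> by auto
    have bounds: "norm (res z l) \<le> r" "norm rr \<le> r"
      using eta_bounds[OF \<rho>3(2)[OF zb(2)]] unfolding r_def rr_def by auto
    have rr_i: "\<bar>rr$i\<bar> \<le> r" for i using component_le_norm_cart[of rr i] bounds(2) by linarith
    have l_eq: "l = \<mu> + rr" unfolding \<mu>_def rr_def by simp
    have \<mu>0: "0 \<le> \<mu>$i" and gr: "g z $ i \<le> - rr$i" and compl: "\<mu>$i * (g z $ i) = - (\<mu>$i * rr$i)" for i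
      unfolding \<mu>_def rr_def slack_def by (auto simp: min_def)
    obtain ls where \<mu>B: "\<And>i. i \<notin> B \<Longrightarrow> \<mu>$i = 0" and ls: "ls \<in> M" "norm (\<mu> - ls) \<le> D0 * (r + n)"
      using D0(3)[OF zb(1) l0(1) zb(4)] unfolding \<mu>_def r_def n_def s_def by blast
    note ls(2)
    also have "D0 * (r + n) \<le> D * n" using rn D0(1) unfolding D_def by simp
    finally have \<mu>ls: "norm (\<mu> - ls) \<le> D * n" .
    have \<mu>ls_i: "\<bar>\<mu>$i - ls$i\<bar> \<le> D * n" for i
      using component_le_norm_cart[of "\<mu> - ls" i] \<mu>ls by simp
    have Dn: "D * n \<le> D" using pos(1) n1(1) mult_left_mono[of n 1 D] by simp
    have \<mu>_i: "\<mu>$i \<le> R + D" for i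
      using \<mu>ls_i[of i] component_le_norm_cart[of ls i] R(2)[OF ls(1)] Dn by linarith
    have lR: "norm l \<le> R + 1"
      using norm_triangle_sub[of l l0] R(2)[OF l0(1)] l0(2) \<delta>(2) by linarith
    have lls: "norm (l - ls) \<le> (D + 1) * n"
      using norm_triangle_ineq[of "\<mu> - ls" rr] \<mu>ls bounds(2) rn unfolding l_eq by (simp add: algebra_simps)
    have s_act: "\<bar>g z $ i - grad_con g i zs \<bullet> s\<bar> \<le> \<kappa> * n" if "i \<in> B" for i
      using \<rho>4(4)[OF zb(3), of i] g_zs_active[OF that] unfolding s_def n_def by simp
    have crit_le: "grad_con g i zs \<bullet> s \<le> 2 * \<kappa> * n" if "i \<in> B" for i
      using s_act[OF that] gr[of i] rr_i[of i] r\<kappa> by linarith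
    \<comment> \<open>The multiplier \<open>ls\<close> may vanish at \<open>i\<close>, so it is
      replaced by \<open>lh\<close> with \<open>lh$i \<ge> \<epsilon>\<close>, which has the same
      gradient combination at \<open>zs\<close>. That combination is close to the one of \<mu>,
      whose product with \<open>s\<close> is at least of order -\<kappa> n by complementarity. By
      \<open>crit_le\<close> the other terms of \<open>lh\<close> cannot be large, so the i-th one
      cannot be very negative.\<close>
    have crit_ge: "\<bar>grad_con g i zs \<bullet> s\<bar> \<le> \<kappa>0 * n" if i: "i \<in> Bp" for i
    proof -
      obtain lh where lh: "lh \<in> M" "\<epsilon> \<le> lh$i" using \<epsilon>(2)[OF i] by blast
      have lh_j: "0 \<le> lh$j" "lh$j \<le> R" for j
        using M_D(1)[OF lh(1)] component_le_norm_cart[of lh j] R(2)[OF lh(1)] by auto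
      have \<mu>_term: "- (2 * (R + D) * (\<kappa> * n)) \<le> \<mu>$j * (grad_con g j zs \<bullet> s)" for j
      proof (cases "j \<in> B")
        case True
        \<comment> \<open>Where \<mu> is nonzero, \<open>compl\<close> gives
          \<open>g z $ j = - rr$j\<close>, so the constraint is nearly tight at
          \<open>z\<close>.\<close>
        have *: "- (2 * (\<kappa> * n)) \<le> grad_con g j zs \<bullet> s" if "\<mu>$j \<noteq> 0"
          using compl[of j] that s_act[OF True] rr_i[of j] r\<kappa> by (simp add: eq_neg_iff_add_eq_0 flip: distrib_left)
        have "\<mu>$j * - (2 * (\<kappa> * n)) \<le> \<mu>$j * (grad_con g j zs \<bullet> s)"
        proof (cases "\<mu>$j = 0")
          case False
          show ?thesis by (rule mult_left_mono[OF *[OF False] \<mu>0])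
        qed simp
        moreover have "\<mu>$j * (2 * (\<kappa> * n)) \<le> (R + D) * (2 * (\<kappa> * n))"
          using \<mu>_i[of j] \<kappa>(1) n by (intro mult_right_mono) auto
        ultimately show ?thesis by (simp add: algebra_simps)
      next
        case False
        have "0 \<le> 2 * (R + D) * (\<kappa> * n)" using R(1) pos(1) \<kappa>(1) n by simp
        then show ?thesis using \<mu>B[OF False] by simp
      qed
      have "(\<Sum>j\<in>(UNIV::'m set). - (2 * (R + D) * (\<kappa> * n))) \<le> (\<Sum>j\<in>UNIV. \<mu>$j * (grad_con g j zs \<bullet> s))"
        by (intro sum_mono \<mu>_term)
      then have mu_sum: "- (2 * m * (R + D) * (\<kappa> * n)) \<le> grad_comb zs \<mu> \<bullet> s"
        unfolding grad_comb_inner m_def by (simp add: algebra_simps)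
      have "\<bar>grad_comb zs (\<mu> - ls) \<bullet> s\<bar> \<le> (K * norm (\<mu> - ls)) * n"
        unfolding n_def using K(2)[of "\<mu> - ls"]
        by (intro order_trans[OF Cauchy_Schwarz_ineq2] mult_right_mono) auto
      also have "\<dots> \<le> (K * (D * n)) * \<kappa>"
        using \<mu>ls K(1) n n1(2) pos(1) by (intro mult_mono) auto
      finally have diff: "grad_comb zs (\<mu> - ls) \<bullet> s \<le> D * K * (\<kappa> * n)" by (simp add: ac_simps)
      have "grad_comb zs lh = grad_comb zs ls"
        using M_D(4)[OF lh(1)] M_D(4)[OF ls(1)] unfolding res_def by (simp add: add_eq_0_iff)
      then have "grad_comb zs lh \<bullet> s = grad_comb zs \<mu> \<bullet> s - grad_comb zs (\<mu> - ls) \<bullet> s"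
        by (simp add: linear_diff[OF linear_grad_comb] inner_diff_left)
      then have lower: "- (2 * m * (R + D) * (\<kappa> * n)) - D * K * (\<kappa> * n) \<le> grad_comb zs lh \<bullet> s"
        using mu_sum diff by linarith
      have lh_term: "lh$j * (grad_con g j zs \<bullet> s) \<le> R * (2 * \<kappa> * n)" for j
      proof (cases "j \<in> B")
        case True
        have "lh$j * (grad_con g j zs \<bullet> s) \<le> lh$j * (2 * \<kappa> * n)"
          using crit_le[OF True] lh_j(1) by (intro mult_left_mono)
        also have "\<dots> \<le> R * (2 * \<kappa> * n)" using lh_j(2) \<kappa>(1) n by (intro mult_right_mono) auto
        finally show ?thesis .
      qed (use M_D(2)[OF lh(1)] R(1) \<kappa>(1) n in auto)
      have "grad_comb zs lh \<bullet> s = lh$i * (grad_con g i zs \<bullet> s) + (\<Sum>j\<in>-{i}. lh$j * (grad_con g j zs \<bullet> s))"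
        unfolding grad_comb_inner using sum.remove[of UNIV i "\<lambda>j. lh$j * (grad_con g j zs \<bullet> s)"]
        by (simp add: Compl_eq_Diff_UNIV)
      also have "(\<Sum>j\<in>-{i}. lh$j * (grad_con g j zs \<bullet> s)) \<le> card (-{i}) * (R * (2 * \<kappa> * n))"
        by (intro sum_bounded_above lh_term)
      also have "\<dots> \<le> m * (R * (2 * \<kappa> * n))"
        unfolding m_def using R(1) \<kappa>(1) n by (intro mult_right_mono) (auto intro: card_mono)
      finally have "- (P * (\<kappa> * n)) \<le> lh$i * (grad_con g i zs \<bullet> s)"
        using lower unfolding P_def by (simp add: algebra_simps)
      moreover have "lh$i * (grad_con g i zs \<bullet> s) \<le> \<epsilon> * (grad_con g i zs \<bullet> s)" if "grad_con g i zs \<bullet> s \<le> 0"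
        using lh(2) that by (intro mult_right_mono_neg) auto
      ultimately have "- (grad_con g i zs \<bullet> s) \<le> P / \<epsilon> * (\<kappa> * n)" if "grad_con g i zs \<bullet> s \<le> 0"
        using \<epsilon>(1) that by (simp add: field_simps)
      moreover have "P / \<epsilon> * (\<kappa> * n) \<le> \<kappa>0 * n"
        using mult_right_mono[OF \<kappa>2(2), of n] n by (simp add: ac_simps)
      moreover have "2 * \<kappa> * n \<le> \<kappa>0 * n" using mult_right_mono[OF \<kappa>2(1), of n] n by simp
      moreover have "0 \<le> P / \<epsilon> * (\<kappa> * n)"
        by (intro mult_nonneg_nonneg less_imp_le[OF P\<epsilon>] less_imp_le[OF \<kappa>(1)] less_imp_le[OF n])
      ultimately show ?thesis using crit_le[of i] i Bp_subset by (cases "grad_con g i zs \<bullet> s \<le> 0") auto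
    qed
    have "\<alpha> * n\<^sup>2 \<le> s \<bullet> (hess \<phi> zs *v s + hess_comb ls s)" unfolding n_def
    proof (rule \<alpha>(3)[OF ls(1)])
      show "\<forall>i\<in>Bp. \<bar>grad_con g i zs \<bullet> s\<bar> \<le> \<kappa>0 * norm s" using crit_ge unfolding n_def by blast
      have "2 * \<kappa> * n \<le> \<kappa>0 * n" using mult_right_mono[OF \<kappa>2(1), of n] n by simp
      then show "\<forall>i\<in>B. grad_con g i zs \<bullet> s \<le> \<kappa>0 * norm s" using crit_le unfolding n_def by force
    qed
    also have "\<dots> \<le> \<kappa> * E * n\<^sup>2"
    proof -
      define e1 where "e1 = grad \<phi> z - grad \<phi> zs - hess \<phi> zs *v s"
      define e2 where "e2 = grad_comb z l - grad_comb zs l - hess_comb l s"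
      have n2: "n * n = n\<^sup>2" by (simp add: power2_eq_square)
      have "norm e1 \<le> \<kappa> * n" using \<rho>4(2)[OF zb(3)] unfolding e1_def s_def n_def .
      then have "\<bar>s \<bullet> e1\<bar> \<le> n * (\<kappa> * n)"
        unfolding n_def by (intro order_trans[OF Cauchy_Schwarz_ineq2] mult_left_mono) auto
      then have e1: "- (\<kappa> * n\<^sup>2) \<le> s \<bullet> e1" by (simp add: ac_simps n2 flip: n2)
      have "norm (\<Sum>i\<in>UNIV. l$i *\<^sub>R (grad_con g i z - grad_con g i zs - hess (\<lambda>x. g x $ i) zs *v s))
          \<le> m * (\<kappa> * n) * norm l"
        unfolding m_def using \<rho>4(3)[OF zb(3)] unfolding s_def n_def by (intro norm_sum_scaleR_le)
      then have "norm e2 \<le> m * (\<kappa> * n) * norm l"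
        unfolding e2_def grad_comb_def hess_comb_def
        by (simp add: sum_subtractf scaleR_diff_right)
      also have "\<dots> \<le> m * (\<kappa> * n) * (R + 1)" using lR m \<kappa>(1) n by (intro mult_left_mono) auto
      finally have "\<bar>s \<bullet> e2\<bar> \<le> n * (m * (\<kappa> * n) * (R + 1))"
        unfolding n_def by (intro order_trans[OF Cauchy_Schwarz_ineq2] mult_left_mono) auto
      then have e2: "- (m * (R + 1) * \<kappa> * n\<^sup>2) \<le> s \<bullet> e2" by (simp add: ac_simps flip: n2)
      have "norm (hess_comb (l - ls) s) \<le> K * norm (l - ls) * n" unfolding n_def by (rule K(3))
      also have "\<dots> \<le> K * ((D + 1) * n) * \<kappa>"
        using lls K(1) pos(1) n n1(2) by (intro mult_mono) auto
      finally have "\<bar>s \<bullet> hess_comb (l - ls) s\<bar> \<le> n * (K * ((D + 1) * n) * \<kappa>)"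
        unfolding n_def by (intro order_trans[OF Cauchy_Schwarz_ineq2] mult_left_mono) auto
      then have h: "- (K * (D + 1) * \<kappa> * n\<^sup>2) \<le> s \<bullet> hess_comb (l - ls) s" by (simp add: ac_simps flip: n2)
      have "norm (grad_comb zs rr) \<le> K * (\<kappa> * n)"
        using K(2)[of rr] mult_left_mono[of "norm rr" "\<kappa> * n" K] bounds(2) r\<kappa> K(1) by linarith
      then have "\<bar>s \<bullet> grad_comb zs rr\<bar> \<le> n * (K * (\<kappa> * n))"
        unfolding n_def by (intro order_trans[OF Cauchy_Schwarz_ineq2] mult_left_mono) auto
      then have rr: "- (K * \<kappa> * n\<^sup>2) \<le> s \<bullet> grad_comb zs rr" by (simp add: ac_simps flip: n2)
      \<comment> \<open>Monotonicity of complementarity: \<mu> is exactly complementary to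
        \<open>g z + rr \<le> 0\<close> and \<open>ls\<close> is nonnegative, so
        \<open>(\<mu> - ls)$i * (g z $ i + rr$i) \<ge> 0\<close>. Replacing
        \<open>g z $ i + rr$i\<close> by the linear term costs an O(n) factor times an O(\<kappa> n)
        factor, hence second order.\<close>
      have term_ge: "- (D * n * (2 * (\<kappa> * n))) \<le> (\<mu> - ls)$i * (grad_con g i zs \<bullet> s)" for i
      proof (cases "i \<in> B")
        case True
        let ?d = "(\<mu> - ls)$i"
        have "ls$i * (g z $ i) \<le> ls$i * - rr$i"
          using gr[of i] M_D(1)[OF ls(1)] by (intro mult_left_mono)
        then have "?d * - rr$i \<le> ?d * (g z $ i)" using compl[of i] by (simp add: left_diff_distrib)
        moreover have "?d * (rr$i + (g z $ i - grad_con g i zs \<bullet> s)) \<le> D * n * (2 * (\<kappa> * n))"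
        proof (rule order_trans[OF abs_ge_self], unfold abs_mult, rule mult_mono)
          show "\<bar>?d\<bar> \<le> D * n" using \<mu>ls_i[of i] by simp
          show "\<bar>rr$i + (g z $ i - grad_con g i zs \<bullet> s)\<bar> \<le> 2 * (\<kappa> * n)"
            using rr_i[of i] r\<kappa> s_act[OF True] by linarith
        qed (use pos(1) n in auto)
        ultimately show ?thesis by (simp add: algebra_simps)
      next
        case False
        then have "(\<mu> - ls)$i = 0" using \<mu>B M_D(2)[OF ls(1)] by simp
        moreover have "0 \<le> D * n * (2 * (\<kappa> * n))" using pos(1) n \<kappa>(1) by simp
        ultimately show ?thesis by simp
      qed
      have "(\<Sum>i\<in>(UNIV::'m set). - (D * n * (2 * (\<kappa> * n)))) \<le> grad_comb zs (\<mu> - ls) \<bullet> s"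
        unfolding grad_comb_inner by (intro sum_mono term_ge)
      then have c: "- (2 * m * D * \<kappa> * n\<^sup>2) \<le> s \<bullet> grad_comb zs (\<mu> - ls)"
        unfolding m_def by (simp add: ac_simps inner_commute flip: n2)
      have "\<bar>s \<bullet> res z l\<bar> \<le> n * (\<kappa> * n)"
        unfolding n_def using bounds(1) r\<kappa>
        by (intro order_trans[OF Cauchy_Schwarz_ineq2] mult_left_mono) (auto simp: n_def)
      then have s_res: "s \<bullet> res z l \<le> \<kappa> * n\<^sup>2" by (simp add: ac_simps flip: n2)
      \<comment> \<open>Expanding this difference and pairing it with \<open>s\<close> isolates the
        curvature; all other terms are bounded below by multiples of -\<kappa> n^2, and the left
        side is at most \<kappa> n^2.\<close>
      have "res z l = res z l - res zs ls" using M_D(4)[OF ls(1)] by simp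
      also have "\<dots> = (hess \<phi> zs *v s + hess_comb ls s) + e1 + e2 + hess_comb (l - ls) s
          + grad_comb zs rr + grad_comb zs (\<mu> - ls)"
        unfolding res_def e1_def e2_def l_eq
        by (simp add: linear_diff[OF linear_grad_comb] linear_add[OF linear_grad_comb]
            linear_diff[OF linear_hess_comb] linear_add[OF linear_hess_comb])
      finally have "s \<bullet> res z l = s \<bullet> (hess \<phi> zs *v s + hess_comb ls s) + s \<bullet> e1 + s \<bullet> e2
          + s \<bullet> hess_comb (l - ls) s + s \<bullet> grad_comb zs rr + s \<bullet> grad_comb zs (\<mu> - ls)"
        by (metis inner_add_right)
      then have "s \<bullet> (hess \<phi> zs *v s + hess_comb ls s) \<le> \<kappa> * n\<^sup>2 + \<kappa> * n\<^sup>2 + m * (R + 1) * \<kappa> * n\<^sup>2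
          + K * (D + 1) * \<kappa> * n\<^sup>2 + K * \<kappa> * n\<^sup>2 + 2 * m * D * \<kappa> * n\<^sup>2"
        using e1 e2 h rr c s_res by linarith
      then show ?thesis unfolding E_def by (simp add: algebra_simps)
    qed
    also have "\<dots> < \<alpha> * n\<^sup>2" using \<kappa>(4) n by simp
    finally show False by simp
  qed
  then show ?thesis using \<kappa>(1) \<delta>(1) by blast
qed

subsection \<open>Comparing the residual with the distance to the KKT set\<close>

lemma dist_KKT_le: "l' \<in> M \<Longrightarrow> dist_KKT \<phi> g zs z l \<le> norm (z - zs) + norm (l - l')"
  unfolding dist_KKT_def KKT_set_def
  using infdist_le[of "(zs, l')" "{zs} \<times> M" "(z, l)"] norm_Pair_le[of "z - zs" "l - l'"]
  by (simp add: dist_norm)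

lemma dist_KKT_nonneg: "0 \<le> dist_KKT \<phi> g zs z l"
  unfolding dist_KKT_def by (rule infdist_nonneg)

lemma dist_KKT_attained:
  obtains l' where "l' \<in> M" "norm (z - zs) \<le> dist_KKT \<phi> g zs z l" "norm (l - l') \<le> dist_KKT \<phi> g zs z l"
proof -
  have "closed (KKT_set \<phi> g zs)" "KKT_set \<phi> g zs \<noteq> {}"
    unfolding KKT_set_def using closed_Times[OF closed_singleton compact_imp_closed[OF M_compact]] M_nonempty
    by auto
  from infdist_attains_inf[OF this, of "(z, l)"] obtain p
    where p: "p \<in> KKT_set \<phi> g zs" "infdist (z, l) (KKT_set \<phi> g zs) = dist (z, l) p" by blast
  then show ?thesis
    using that[of "snd p"] norm_fst_le[of "z - zs" "l - snd p"] norm_snd_le[of "l - snd p" "z - zs"]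
    unfolding dist_KKT_def KKT_set_def by (auto simp: dist_norm)
qed

lemma eta_upper_bound:
  "\<exists>C>0. \<exists>\<delta>>0. \<forall>z l. dist_KKT \<phi> g zs z l \<le> \<delta> \<longrightarrow> eta \<phi> g z l \<le> C * dist_KKT \<phi> g zs z l"
proof -
  obtain K \<rho>1 where K: "K > 0" "\<rho>1 > 0"
    "\<And>z. norm (z - zs) \<le> \<rho>1 \<Longrightarrow> norm (grad \<phi> z - grad \<phi> zs) \<le> K * norm (z - zs)"
    "\<And>z u. norm (z - zs) \<le> \<rho>1 \<Longrightarrow> norm (grad_comb z u - grad_comb zs u) \<le> K * norm (z - zs) * norm u"
    "\<And>z i. norm (z - zs) \<le> \<rho>1 \<Longrightarrow> \<bar>g z $ i - g zs $ i\<bar> \<le> K * norm (z - zs)"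
    "\<And>u. norm (grad_comb zs u) \<le> K * norm u"
    by (rule local_lipschitz) blast
  obtain R where R: "R > 0" "\<And>l. l \<in> M \<Longrightarrow> norm l \<le> R" using M_bounded by blast
  obtain \<rho>2 where \<rho>2: "\<rho>2 > 0" "\<And>z l. norm (z - zs) \<le> \<rho>2 \<Longrightarrow> lagr_z \<phi> g z l = res z l"
    using lagr_z_eq by blast
  define C where "C = K * (R + 3) + CARD('m) * (1 + K)"
  define \<delta> where "\<delta> = min 1 (min \<rho>1 \<rho>2)"
  have "eta \<phi> g z l \<le> C * dist_KKT \<phi> g zs z l" if d: "dist_KKT \<phi> g zs z l \<le> \<delta>" for z l
  proof -
    define d where "d = dist_KKT \<phi> g zs z l"
    obtain l0 where l0: "l0 \<in> M" "norm (z - zs) \<le> d" "norm (l - l0) \<le> d"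
      using dist_KKT_attained unfolding d_def by metis
    have b: "norm (z - zs) \<le> \<rho>1" "norm (z - zs) \<le> \<rho>2" "norm (l - l0) \<le> 1"
      using l0 d unfolding d_def \<delta>_def by auto
    have Kd: "K * norm (z - zs) \<le> K * d" using K(1) l0(2) by simp
    have "norm l \<le> R + 1" using norm_triangle_sub[of l l0] R(2)[OF l0(1)] b(3) by linarith
    then have "K * norm (z - zs) * norm l \<le> K * d * (R + 1)"
      using Kd K(1) order_trans[OF norm_ge_zero l0(2)] by (intro mult_mono) auto
    moreover have "K * norm (l - l0) \<le> K * d" using K(1) l0(3) by simp
    moreover have "res z l = (grad \<phi> z - grad \<phi> zs) + (grad_comb z l - grad_comb zs l) + grad_comb zs (l - l0)"
      using M_D(4)[OF l0(1)] unfolding res_def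
      by (simp add: linear_diff[OF linear_grad_comb] algebra_simps)
    then have "norm (res z l) \<le> norm (grad \<phi> z - grad \<phi> zs) + norm (grad_comb z l - grad_comb zs l)
        + norm (grad_comb zs (l - l0))"
      using norm_triangle_ineq[of "(grad \<phi> z - grad \<phi> zs) + (grad_comb z l - grad_comb zs l)" "grad_comb zs (l - l0)"]
        norm_triangle_ineq[of "grad \<phi> z - grad \<phi> zs" "grad_comb z l - grad_comb zs l"] by simp
    ultimately have "norm (res z l) \<le> K * d + K * d * (R + 1) + K * d"
      using K(3)[OF b(1)] K(4)[OF b(1), of l] K(6)[of "l - l0"] Kd by linarith
    moreover have "norm (slack z l) \<le> CARD('m) * ((1 + K) * d)"
    proof (rule norm_le_card_mult)
      fix i
      \<comment> \<open>At \<open>(zs, l0)\<close> the componentwise minimum is 0, so the estimate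
        is the Lipschitz property of the minimum.\<close>
      have "0 \<le> l0$i" "g zs $ i \<le> 0" "l0$i = 0 \<or> g zs $ i = 0"
        using M_D(1,2)[OF l0(1), of i] g_zs_nonpos[of i] unfolding active_def by auto
      then have "\<bar>min (l$i) (- (g z $ i))\<bar> \<le> \<bar>l$i - l0$i\<bar> + \<bar>g z $ i - g zs $ i\<bar>"
        by linarith
      then have "\<bar>slack z l $ i\<bar> \<le> \<bar>l$i - l0$i\<bar> + \<bar>g z $ i - g zs $ i\<bar>"
        unfolding slack_def by simp
      also have "\<dots> \<le> d + K * d"
        using component_le_norm_cart[of "l - l0" i] l0(3) K(5)[OF b(1), of i] Kd by simp
      finally show "\<bar>slack z l $ i\<bar> \<le> (1 + K) * d" by (simp add: distrib_right)
    qed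
    ultimately have "eta \<phi> g z l \<le> C * d"
      using eta_bounds(3)[OF \<rho>2(2)[OF b(2)], of l] unfolding C_def by (simp add: algebra_simps)
    then show ?thesis unfolding d_def .
  qed
  moreover have "C > 0" unfolding C_def using K(1) R(1) by (intro add_pos_pos mult_pos_pos) auto
  moreover have "\<delta> > 0" unfolding \<delta>_def using K(2) \<rho>2(1) by simp
  ultimately show ?thesis by blast
qed

lemma eta_lower_bound:
  "\<exists>c>0. \<exists>\<delta>>0. \<forall>z l. dist_KKT \<phi> g zs z l \<le> \<delta> \<longrightarrow> dist_KKT \<phi> g zs z l \<le> c * eta \<phi> g z l"
proof -
  obtain \<kappa> \<delta>1 where \<kappa>: "\<kappa> > 0" "\<delta>1 > 0" "\<And>z l l0. norm (z - zs) \<le> \<delta>1 \<Longrightarrow> l0 \<in> M \<Longrightarrow>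
      norm (l - l0) \<le> \<delta>1 \<Longrightarrow> \<kappa> * norm (z - zs) \<le> eta \<phi> g z l"
    using primal_error_bound by blast
  obtain D \<delta>2 where D: "D > 0" "\<delta>2 > 0" "\<And>z l l0. norm (z - zs) \<le> \<delta>2 \<Longrightarrow> l0 \<in> M \<Longrightarrow>
      norm (l - l0) \<le> \<delta>2 \<Longrightarrow> \<exists>ls\<in>M. norm (l - slack z l - ls) \<le> D * (eta \<phi> g z l + norm (z - zs))"
    using shifted_multiplier by blast
  obtain \<rho> where \<rho>: "\<rho> > 0" "\<And>z l. norm (z - zs) \<le> \<rho> \<Longrightarrow> lagr_z \<phi> g z l = res z l"
    using lagr_z_eq by blast
  define \<delta> where "\<delta> = min \<rho> (min \<delta>1 \<delta>2)"
  \<comment> \<open>The summands come from \<open>norm (z - zs)\<close>, from undoing the shift by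
    the slack, and from the shifted multiplier after inserting the primal bound.\<close>
  define c where "c = 1 / \<kappa> + 1 + D * (1 + 1 / \<kappa>)"
  have "dist_KKT \<phi> g zs z l \<le> c * eta \<phi> g z l" if d: "dist_KKT \<phi> g zs z l \<le> \<delta>" for z l
  proof -
    obtain l0 where l0: "l0 \<in> M" "norm (z - zs) \<le> \<delta>" "norm (l - l0) \<le> \<delta>"
      using dist_KKT_attained d order_trans by metis
    have z: "norm (z - zs) \<le> eta \<phi> g z l / \<kappa>"
      using \<kappa>(3)[OF _ l0(1), of z l] l0 \<kappa>(1) unfolding \<delta>_def by (simp add: pos_le_divide_eq mult.commute)
    obtain ls where ls: "ls \<in> M" "norm (l - slack z l - ls) \<le> D * (eta \<phi> g z l + norm (z - zs))"
      using D(3)[OF _ l0(1), of z l] l0 unfolding \<delta>_def by auto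
    note ls(2)
    also have "D * (eta \<phi> g z l + norm (z - zs)) \<le> D * (eta \<phi> g z l + eta \<phi> g z l / \<kappa>)"
      using z D(1) by (intro mult_left_mono) auto
    finally have "norm (l - slack z l - ls) \<le> D * (eta \<phi> g z l + eta \<phi> g z l / \<kappa>)" .
    moreover have "norm (slack z l) \<le> eta \<phi> g z l"
      using eta_bounds(2) \<rho>(2) l0(2) unfolding \<delta>_def by simp
    ultimately have "norm (l - ls) \<le> D * (eta \<phi> g z l + eta \<phi> g z l / \<kappa>) + eta \<phi> g z l"
      using norm_triangle_ineq[of "l - slack z l - ls" "slack z l"] by simp
    then show ?thesis using dist_KKT_le[OF ls(1), of z l] z unfolding c_def by (simp add: algebra_simps)
  qed
  moreover have "\<delta> > 0" unfolding \<delta>_def using \<rho> \<kappa> D by simp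
  moreover have "c > 0" unfolding c_def using \<kappa>(1) D(1) by (intro add_pos_pos mult_pos_pos) auto
  ultimately show ?thesis by blast
qed

subsection \<open>Feasible multipliers and identification\<close>

lemma mult_feasible_iff:
  "u \<in> mult_feasible \<phi> g \<tau> z l I \<longleftrightarrow>
     (\<forall>j. \<bar>res z u $ j\<bar> \<le> eta \<phi> g z l powr \<tau>) \<and> 0 \<le> u \<and> (\<forall>i. i \<notin> I \<longrightarrow> u$i = 0)"
proof (cases "\<forall>i. i \<notin> I \<longrightarrow> u$i = 0")
  case True
  have sum: "(\<Sum>i\<in>I. u $ i *\<^sub>R grad_con g i z) = grad_comb z u"
    unfolding grad_comb_def using True by (intro sum.mono_neutral_left) auto
  have nonneg: "(\<forall>i\<in>I. 0 \<le> u$i) \<longleftrightarrow> 0 \<le> u"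
    using True unfolding less_eq_vec_def by (metis order_refl zero_index)
  show ?thesis
    unfolding mult_feasible_def mem_Collect_eq sum nonneg res_def[symmetric]
    by (auto simp: less_eq_vec_def abs_le_iff minus_le_iff)
qed (auto simp: mult_feasible_def)

lemma mult_feasible_D:
  assumes "u \<in> mult_feasible \<phi> g \<tau> z l I"
  shows "norm (res z u) \<le> CARD('n) * eta \<phi> g z l powr \<tau>" "0 \<le> u" "i \<notin> I \<Longrightarrow> u$i = 0"
  using assms unfolding mult_feasible_iff by (auto intro: norm_le_card_mult)

text \<open>KKT multipliers vanish off \<open>Bp\<close>, so any index set containing
  \<open>Bp\<close> will do: the whole active set in the loop, the returned set in the final
  program.\<close>

lemma M_mult_feasible:
  assumes "l' \<in> M" "norm (res z l') \<le> eta \<phi> g z l powr \<tau>" "Bp \<subseteq> I"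
  shows "l' \<in> mult_feasible \<phi> g \<tau> z l I"
  unfolding mult_feasible_iff
  using M_D(1,3)[OF assms(1)] assms(2,3) order_trans[OF component_le_norm_cart assms(2)]
  by (auto simp: less_eq_vec_def)

lemma closed_mult_feasible: "closed (mult_feasible \<phi> g \<tau> z l I)"
proof -
  have "mult_feasible \<phi> g \<tau> z l I = (\<Inter>j. {u. \<bar>res z u $ j\<bar> \<le> eta \<phi> g z l powr \<tau>}) \<inter>
      (\<Inter>i. {u. 0 \<le> u$i}) \<inter> (\<Inter>i\<in>-I. {u. u$i = 0})"
    using mult_feasible_iff by (auto simp: less_eq_vec_def)
  then show ?thesis
    by (simp only:) (intro closed_Int closed_INT ballI closed_Collect_le closed_Collect_eq
        continuous_intros continuous_on_res)
qed

text \<open>The box constraints bound the stationarity residual, so the multiplier error bound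
  applies whenever the support is active. This serves three times: compactness for solvability and
  boundedness, the threshold test in the loop, and the final distance estimate.\<close>

lemma mult_feasible_near_M:
  fixes \<tau> :: real
  obtains C \<delta> where "C > 0" "\<delta> > 0"
    "\<And>z l I. norm (z - zs) \<le> \<delta> \<Longrightarrow> I \<subseteq> B \<Longrightarrow> compact (mult_feasible \<phi> g \<tau> z l I)"
    "\<And>z l I u. norm (z - zs) \<le> \<delta> \<Longrightarrow> I \<subseteq> B \<Longrightarrow> u \<in> mult_feasible \<phi> g \<tau> z l I \<Longrightarrow>
      \<exists>ls\<in>M. norm (u - ls) \<le> C * (eta \<phi> g z l powr \<tau> + norm (z - zs))"
proof -
  obtain C0 \<rho> where C0: "C0 > 0" "\<rho> > 0" "\<And>z u. norm (z - zs) \<le> \<rho> \<Longrightarrow> 0 \<le> u \<Longrightarrow>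
      (\<forall>i. i \<notin> B \<longrightarrow> u$i = 0) \<Longrightarrow> \<exists>l\<in>M. norm (u - l) \<le> C0 * (norm (res z u) + norm (z - zs))"
    using M_local_error_bound by blast
  obtain R where R: "R > 0" "\<And>l. l \<in> M \<Longrightarrow> norm l \<le> R" using M_bounded by blast
  define C where "C = C0 * CARD('n)"
  have near: "\<exists>ls\<in>M. norm (u - ls) \<le> C * (eta \<phi> g z l powr \<tau> + norm (z - zs))"
    if z: "norm (z - zs) \<le> \<rho>" and I: "I \<subseteq> B" and u: "u \<in> mult_feasible \<phi> g \<tau> z l I" for z l I u
  proof -
    obtain ls where ls: "ls \<in> M" "norm (u - ls) \<le> C0 * (norm (res z u) + norm (z - zs))"
      using C0(3)[OF z mult_feasible_D(2)[OF u]] mult_feasible_D(3)[OF u] I by blast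
    note ls(2)
    also have "C0 * (norm (res z u) + norm (z - zs))
        \<le> C0 * (CARD('n) * eta \<phi> g z l powr \<tau> + CARD('n) * norm (z - zs))"
      using mult_feasible_D(1)[OF u] C0(1) by (intro mult_left_mono add_mono) (auto simp: mult_le_cancel_right1)
    finally show ?thesis using ls(1) unfolding C_def by (auto simp: algebra_simps)
  qed
  moreover have "compact (mult_feasible \<phi> g \<tau> z l I)" if "norm (z - zs) \<le> \<rho>" "I \<subseteq> B" for z l I
  proof -
    have "norm u \<le> C * (eta \<phi> g z l powr \<tau> + norm (z - zs)) + R" if "u \<in> mult_feasible \<phi> g \<tau> z l I" for u
    proof -
      obtain ls where "ls \<in> M" "norm (u - ls) \<le> C * (eta \<phi> g z l powr \<tau> + norm (z - zs))"
        using near \<open>norm (z - zs) \<le> \<rho>\<close> \<open>I \<subseteq> B\<close> \<open>u \<in> mult_feasible \<phi> g \<tau> z l I\<close> by blast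
      then show ?thesis using norm_triangle_sub[of u ls] R(2) by fastforce
    qed
    then have "bounded (mult_feasible \<phi> g \<tau> z l I)" unfolding bounded_iff by blast
    then show ?thesis using closed_mult_feasible by (simp add: compact_eq_bounded_closed)
  qed
  moreover have "C > 0" unfolding C_def using C0(1) by simp
  ultimately show ?thesis using that[of C \<rho>] C0(2) near by blast
qed

text \<open>Positive distance makes the residual positive, and only there are its powers strictly
  separated; at residual 0 all of them coincide.\<close>

lemma identification:
  assumes \<tau>: "0 < \<tau>'" "\<tau>' < \<tau>" "\<tau> < 1"
  shows "\<exists>\<delta>>0. \<forall>z l. 0 < dist_KKT \<phi> g zs z l \<longrightarrow> dist_KKT \<phi> g zs z l \<le> \<delta> \<longrightarrow>
    est_active \<phi> g \<tau> z l = B \<and> (\<forall>l'\<in>M. norm (res z l') \<le> eta \<phi> g z l powr \<tau>) \<and>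
    (\<forall>A0 Ap. ID0_returns \<phi> g \<tau> \<tau>' z l A0 Ap \<longrightarrow> Ap = Bp)"
proof -
  obtain K \<rho>1 where K: "K > 0" "\<rho>1 > 0"
    "\<And>z. norm (z - zs) \<le> \<rho>1 \<Longrightarrow> norm (grad \<phi> z - grad \<phi> zs) \<le> K * norm (z - zs)"
    "\<And>z u. norm (z - zs) \<le> \<rho>1 \<Longrightarrow> norm (grad_comb z u - grad_comb zs u) \<le> K * norm (z - zs) * norm u"
    "\<And>z i. norm (z - zs) \<le> \<rho>1 \<Longrightarrow> \<bar>g z $ i - g zs $ i\<bar> \<le> K * norm (z - zs)"
    by (rule local_lipschitz) blast
  obtain R where R: "R > 0" "\<And>l. l \<in> M \<Longrightarrow> norm l \<le> R" using M_bounded by blast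
  obtain \<gamma> where \<gamma>: "\<gamma> > 0" "\<And>i. i \<notin> B \<Longrightarrow> g zs $ i \<le> - \<gamma>" using inactive_gap by blast
  obtain \<epsilon> where \<epsilon>: "\<epsilon> > 0" "\<And>i. i \<in> Bp \<Longrightarrow> \<exists>l\<in>M. \<epsilon> \<le> l$i" using Bp_multiplier by blast
  obtain C \<delta>1 where C: "C > 0" "\<delta>1 > 0"
    "\<And>z l. dist_KKT \<phi> g zs z l \<le> \<delta>1 \<Longrightarrow> eta \<phi> g z l \<le> C * dist_KKT \<phi> g zs z l"
    using eta_upper_bound by blast
  obtain c \<delta>2 where c: "c > 0" "\<delta>2 > 0"
    "\<And>z l. dist_KKT \<phi> g zs z l \<le> \<delta>2 \<Longrightarrow> dist_KKT \<phi> g zs z l \<le> c * eta \<phi> g z l"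
    using eta_lower_bound by blast
  obtain D \<delta>3 where D: "D > 0" "\<delta>3 > 0" "\<And>z l I u. norm (z - zs) \<le> \<delta>3 \<Longrightarrow> I \<subseteq> B \<Longrightarrow>
      u \<in> mult_feasible \<phi> g \<tau> z l I \<Longrightarrow>
      \<exists>ls\<in>M. norm (u - ls) \<le> D * (eta \<phi> g z l powr \<tau> + norm (z - zs))"
    by (rule mult_feasible_near_M[of \<tau>]) blast
  define m where "m = real CARD('m)"
  have m: "m > 0" unfolding m_def by simp
  \<comment> \<open>In order: KKT multipliers are feasible and active constraints are recognised;
    inactive ones are rejected; \<open>l\<close> is below threshold on \<open>B0\<close>; the fourth
    and fifth keep all feasible points below threshold on \<open>B0\<close>; below-threshold values
    cannot add up to \<epsilon>.\<close>
  have "eventually (\<lambda>x. (K * (1 + R) * c) * x powr 1 < x powr \<tau> \<and> (2 / \<gamma>) * x powr \<tau> < x powr 0 \<and>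
      c * x powr 1 < x powr \<tau>' \<and> (D * c) * x powr 1 < x powr \<tau> \<and> (D + 1) * x powr \<tau> < x powr \<tau>' \<and>
      (m / \<epsilon>) * x powr \<tau>' < x powr 0) (at_right 0)"
    using \<tau> by (intro eventually_conj powr_dominates) auto
  then obtain h where h: "h > 0" and small: "\<And>x. 0 < x \<Longrightarrow> x < h \<Longrightarrow>
      (K * (1 + R) * c) * x powr 1 < x powr \<tau> \<and> (2 / \<gamma>) * x powr \<tau> < x powr 0 \<and>
      c * x powr 1 < x powr \<tau>' \<and> (D * c) * x powr 1 < x powr \<tau> \<and> (D + 1) * x powr \<tau> < x powr \<tau>' \<and>
      (m / \<epsilon>) * x powr \<tau>' < x powr 0"
    unfolding eventually_at_right_field by blast
  \<comment> \<open>The last two entries let an inactive constraint move by at most half its gap,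
    and keep the residual at most \<open>h / 2\<close>.\<close>
  define \<delta> where "\<delta> = Min {\<rho>1, \<delta>1, \<delta>2, \<delta>3, \<gamma> / (2 * K), h / (2 * C)}"
  have \<delta>0: "\<delta> > 0" unfolding \<delta>_def
    using K(1,2) C(1,2) c(2) D(2) \<gamma>(1) h by (subst Min_gr_iff) auto
  have \<delta>: "\<delta> \<le> \<rho>1" "\<delta> \<le> \<delta>1" "\<delta> \<le> \<delta>2" "\<delta> \<le> \<delta>3" "\<delta> \<le> \<gamma> / (2 * K)" "\<delta> \<le> h / (2 * C)"
    unfolding \<delta>_def by (intro Min_le; simp)+
  have "est_active \<phi> g \<tau> z l = B \<and> (\<forall>l'\<in>M. norm (res z l') \<le> eta \<phi> g z l powr \<tau>) \<and>
      (\<forall>A0 Ap. ID0_returns \<phi> g \<tau> \<tau>' z l A0 Ap \<longrightarrow> Ap = Bp)"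
    if d: "0 < dist_KKT \<phi> g zs z l" "dist_KKT \<phi> g zs z l \<le> \<delta>" for z l
  proof -
    define x where "x = eta \<phi> g z l"
    obtain l0 where l0: "l0 \<in> M" "norm (z - zs) \<le> dist_KKT \<phi> g zs z l" "norm (l - l0) \<le> dist_KKT \<phi> g zs z l"
      by (rule dist_KKT_attained)
    have dx: "dist_KKT \<phi> g zs z l \<le> c * x" using c(3) d(2) \<delta>(3) unfolding x_def by simp
    then have "0 < c * x" using d(1) by simp
    then have x0: "0 < x" using c(1) by (simp add: zero_less_mult_iff)
    have "x \<le> C * dist_KKT \<phi> g zs z l" using C(3) d(2) \<delta>(2) unfolding x_def by simp
    also have "\<dots> \<le> C * (h / (2 * C))" using d(2) \<delta>(6) C(1) by (intro mult_left_mono) auto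
    finally have "x < h" using C(1) h by simp
    note small[OF x0 this]
    then have s: "K * (1 + R) * (c * x) \<le> x powr \<tau>" "x powr \<tau> < \<gamma> / 2" "c * x < x powr \<tau>'"
      "D * (c * x) \<le> x powr \<tau>" "(D + 1) * x powr \<tau> < x powr \<tau>'" "x powr \<tau>' < \<epsilon> / m"
      using x0 \<gamma>(1) \<epsilon>(1) m by (auto simp: field_simps)
    have zb: "norm (z - zs) \<le> \<rho>1" "norm (z - zs) \<le> \<delta>3" "norm (z - zs) \<le> \<gamma> / (2 * K)"
      "norm (z - zs) \<le> c * x" "norm (l - l0) \<le> c * x" using l0 d(2) \<delta> dx by auto
    have Kz: "K * norm (z - zs) \<le> K * (c * x)" "K * norm (z - zs) \<le> \<gamma> / 2"
      using zb(3,4) K(1) by (auto simp: field_simps)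
    have "0 \<le> R * (K * (c * x))" using R(1) K(1) c(1) x0 by simp
    then have Kcx: "K * (c * x) \<le> x powr \<tau>" using s(1) by (simp add: algebra_simps)
    have active: "est_active \<phi> g \<tau> z l = B"
    proof -
      have "i \<in> B" if "- (x powr \<tau>) \<le> g z $ i" for i
      proof (rule ccontr)
        assume "i \<notin> B"
        then show False using \<gamma>(2)[of i] K(5)[OF zb(1), of i] Kz(2) s(2) that by linarith
      qed
      moreover have "- (x powr \<tau>) \<le> g z $ i" if "i \<in> B" for i
        using g_zs_active[OF that] K(5)[OF zb(1), of i] Kz(1) Kcx by linarith
      ultimately show ?thesis unfolding est_active_def x_def[symmetric] by auto
    qed
    have M_res: "norm (res z l') \<le> x powr \<tau>" if "l' \<in> M" for l'
    proof -
      have "res z l' = (grad \<phi> z - grad \<phi> zs) + (grad_comb z l' - grad_comb zs l')"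
        using M_D(4)[OF that] unfolding res_def by (simp add: algebra_simps)
      then have "norm (res z l') \<le> K * norm (z - zs) + K * norm (z - zs) * norm l'"
        using norm_triangle_ineq[of "grad \<phi> z - grad \<phi> zs" "grad_comb z l' - grad_comb zs l'"]
          K(3)[OF zb(1)] K(4)[OF zb(1), of l'] by simp
      also have "\<dots> \<le> K * (c * x) + K * (c * x) * R"
        using Kz(1) R(2)[OF that] K(1) c(1) x0 by (intro add_mono mult_mono) auto
      also have "\<dots> \<le> x powr \<tau>" using s(1) by (simp add: algebra_simps)
      finally show ?thesis .
    qed
    have B0_zero: "ls$i = 0" if "ls \<in> M" "i \<in> B0" for ls i
      using M_D(3)[OF that(1)] that(2) unfolding B0_eq by blast
    have keep: "B0 \<inter> ID0_C \<phi> g \<tau>' z l H u = {}" if "ID0_LP_solution \<phi> g \<tau> z l H u" for H u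
    proof -
      have "u \<in> mult_feasible \<phi> g \<tau> z l B"
        using that unfolding ID0_LP_solution_def is_arg_max_linorder active by blast
      then obtain ls where ls: "ls \<in> M" "norm (u - ls) \<le> D * (x powr \<tau> + norm (z - zs))"
        using D(3)[OF zb(2) order_refl] unfolding x_def by blast
      have "D * norm (z - zs) \<le> D * (c * x)" using zb(4) D(1) by simp
      then have "norm (u - ls) < x powr \<tau>'" using ls(2) s(4,5) by (simp add: algebra_simps)
      then have "u$i < x powr \<tau>'" if "i \<in> B0" for i
        using component_le_norm_cart[of "u - ls" i] B0_zero[OF ls(1) that] by simp
      then show ?thesis unfolding ID0_C_def x_def by fastforce
    qed
    \<comment> \<open>If a strongly active index is left, a KKT multiplier is a competitor with
      objective at least \<epsilon>, more than a solution with every entry on \<open>H\<close> below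
      the threshold can reach.\<close>
    have progress: "H \<subseteq> B0" if u: "ID0_LP_solution \<phi> g \<tau> z l H u"
      and H: "H \<subseteq> est_active \<phi> g \<tau> z l" and C: "ID0_C \<phi> g \<tau>' z l H u = {}" for H u
    proof (rule ccontr)
      assume "\<not> H \<subseteq> B0"
      then obtain i where i: "i \<in> H" "i \<in> Bp" using H unfolding active B0_eq by blast
      then obtain l' where l': "l' \<in> M" "\<epsilon> \<le> l'$i" using \<epsilon>(2) by blast
      have "l' \<in> mult_feasible \<phi> g \<tau> z l B"
        using M_mult_feasible[OF l'(1) _ Bp_subset] M_res[OF l'(1)] unfolding x_def by blast
      then have "(\<Sum>j\<in>H. l'$j) \<le> (\<Sum>j\<in>H. u$j)"
        using u unfolding ID0_LP_solution_def is_arg_max_linorder active by blast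
      moreover have "l'$i \<le> (\<Sum>j\<in>H. l'$j)"
        using i(1) M_D(1)[OF l'(1)] by (intro member_le_sum) auto
      moreover have "u$j \<le> x powr \<tau>'" if "j \<in> H" for j
        using C that unfolding ID0_C_def x_def by (auto simp: not_le intro: less_imp_le)
      then have "(\<Sum>j\<in>H. u$j) \<le> card H * x powr \<tau>'" by (rule sum_bounded_above)
      moreover have "card H * x powr \<tau>' \<le> m * x powr \<tau>'"
        unfolding m_def by (intro mult_right_mono) (auto intro: card_mono)
      ultimately show False using l'(2) s(6) m by (simp add: field_simps)
    qed
    have "Ap = Bp" if "ID0_returns \<phi> g \<tau> \<tau>' z l A0 Ap" for A0 Ap
    proof -
      have "l$i < x powr \<tau>'" if "i \<in> B0" for i
        using component_le_norm_cart[of "l - l0" i] zb(5) s(3) B0_zero[OF l0(1) that] by simp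
      then have "B0 \<subseteq> ID0_init \<phi> g \<tau> \<tau>' z l"
        unfolding ID0_init_def active x_def B0_eq by fastforce
      moreover have "ID0_init \<phi> g \<tau> \<tau>' z l \<subseteq> est_active \<phi> g \<tau> z l"
        unfolding ID0_init_def by blast
      ultimately have "Ap = est_active \<phi> g \<tau> z l - B0"
        by (intro ID0_loop_result[OF that[unfolded ID0_returns_def] _ _ keep progress])
      then show ?thesis unfolding active B0_eq using Bp_subset by blast
    qed
    then show ?thesis using active M_res unfolding x_def by blast
  qed
  then show ?thesis using \<delta>0 by blast
qed

lemma at_solution:
  assumes "dist_KKT \<phi> g zs z l = 0"
  shows "est_active \<phi> g \<tau> z l = B" "l' \<in> M \<Longrightarrow> norm (res z l') \<le> eta \<phi> g z l powr \<tau>"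
    "ID0_returns \<phi> g \<tau> \<tau>' z l A0 Ap \<Longrightarrow> Ap = B"
proof -
  obtain l0 where "l0 \<in> M" "norm (z - zs) \<le> 0" "norm (l - l0) \<le> 0"
    using dist_KKT_attained[of z l] assms by metis
  then have z: "z = zs" and l: "l \<in> M" by auto
  obtain C \<delta>1 where "\<delta>1 > 0" and
    C: "\<And>z l. dist_KKT \<phi> g zs z l \<le> \<delta>1 \<Longrightarrow> eta \<phi> g z l \<le> C * dist_KKT \<phi> g zs z l"
    using eta_upper_bound by blast
  from this(1) C[of z l] assms have eta0: "eta \<phi> g z l = 0" by (simp add: eta_def)
  show active: "est_active \<phi> g \<tau> z l = B"
    unfolding est_active_def active_def eta0 using g_zs_nonpos by (auto simp: z intro: antisym)
  show "norm (res z l') \<le> eta \<phi> g z l powr \<tau>" if "l' \<in> M" using M_D(4)[OF that] z by simp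
  assume ret: "ID0_returns \<phi> g \<tau> \<tau>' z l A0 Ap"
  \<comment> \<open>\<open>0 powr \<tau>'\<close> is 0, so every index passes the threshold because
    \<open>l \<ge> 0\<close>. On an empty working set only \<open>stop_C_empty\<close> can
    apply.\<close>
  have "ID0_init \<phi> g \<tau> \<tau>' z l = {}" unfolding ID0_init_def eta0 using M_D(1)[OF l] by auto
  with ret have "ID0_loop \<phi> g \<tau> \<tau>' z l {} A0 Ap" unfolding ID0_returns_def by simp
  then show "Ap = B" by cases (auto simp: ID0_C_def active)
qed

end

theorem theorem5:
  fixes \<phi> :: "real^'n \<Rightarrow> real" and g :: "real^'n \<Rightarrow> real^'m"
    and zs :: "real^'n" and \<tau> \<tau>' :: real
  assumes "0 < \<tau>'" and "\<tau>' < \<tau>" and "\<tau> < 1"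
    and "assumption_A \<phi> g zs"
    and "active_plus \<phi> g zs \<noteq> {}"
  shows "\<exists>\<delta>3>0.
    (\<forall>z l. dist_KKT \<phi> g zs z l \<le> \<delta>3 \<longrightarrow>
       (\<exists>A0 Ap. ID0_returns \<phi> g \<tau> \<tau>' z l A0 Ap) \<and>
       (\<forall>A0 Ap. ID0_returns \<phi> g \<tau> \<tau>' z l A0 Ap \<longrightarrow>
          LP_feasible \<phi> g \<tau> z l Ap \<noteq> {} \<and>
          bdd_above (fst ` LP_feasible \<phi> g \<tau> z l Ap) \<and>
          (0 < dist_KKT \<phi> g zs z l \<longrightarrow> eps_lambda \<phi> g zs \<le> LP_value \<phi> g \<tau> z l Ap))) \<and>
    (\<exists>\<beta>'>0. \<forall>z l. dist_KKT \<phi> g zs z l \<le> \<delta>3 \<longrightarrow>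
       (\<forall>A0 Ap t lh. ID0_returns \<phi> g \<tau> \<tau>' z l A0 Ap \<longrightarrow> LP_solution \<phi> g \<tau> z l Ap (t, lh) \<longrightarrow>
          dist_KKT \<phi> g zs z lh \<le> \<beta>' * dist_KKT \<phi> g zs z l powr \<tau>))"
proof -
  interpret kkt_point \<phi> g zs by unfold_locales fact
  note \<tau> = assms(1-3) and Bp = assms(5)
  obtain \<delta>1 where \<delta>1: "\<delta>1 > 0"
    "\<And>z l. 0 < dist_KKT \<phi> g zs z l \<Longrightarrow> dist_KKT \<phi> g zs z l \<le> \<delta>1 \<Longrightarrow>
      est_active \<phi> g \<tau> z l = B \<and> (\<forall>l'\<in>M. norm (res z l') \<le> eta \<phi> g z l powr \<tau>) \<and>
      (\<forall>A0 Ap. ID0_returns \<phi> g \<tau> \<tau>' z l A0 Ap \<longrightarrow> Ap = Bp)"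
    using identification[OF \<tau>] by blast
  obtain D \<delta>2 where D: "D > 0" "\<delta>2 > 0"
    "\<And>z l I. norm (z - zs) \<le> \<delta>2 \<Longrightarrow> I \<subseteq> B \<Longrightarrow> compact (mult_feasible \<phi> g \<tau> z l I)"
    "\<And>z l I u. norm (z - zs) \<le> \<delta>2 \<Longrightarrow> I \<subseteq> B \<Longrightarrow> u \<in> mult_feasible \<phi> g \<tau> z l I \<Longrightarrow>
      \<exists>ls\<in>M. norm (u - ls) \<le> D * (eta \<phi> g z l powr \<tau> + norm (z - zs))"
    by (rule mult_feasible_near_M[of \<tau>]) blast
  obtain C \<delta>4 where C: "C > 0" "\<delta>4 > 0"
    "\<And>z l. dist_KKT \<phi> g zs z l \<le> \<delta>4 \<Longrightarrow> eta \<phi> g z l \<le> C * dist_KKT \<phi> g zs z l"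
    using eta_upper_bound by blast
  define \<delta>3 where "\<delta>3 = min (min 1 \<delta>1) (min \<delta>2 \<delta>4)"
  have \<delta>3: "\<delta>3 > 0" "\<delta>3 \<le> 1" "\<delta>3 \<le> \<delta>1" "\<delta>3 \<le> \<delta>2" "\<delta>3 \<le> \<delta>4"
    unfolding \<delta>3_def using \<delta>1(1) D(2) C(2) by auto
  have z: "norm (z - zs) \<le> dist_KKT \<phi> g zs z l" for z l by (rule dist_KKT_attained[of z l])
  \<comment> \<open>On and off the KKT set the returned set lies between \<open>Bp\<close> and
    \<open>B\<close>; this alone yields feasibility, boundedness and the distance estimate. Equality
    with \<open>Bp\<close> is used only for the value.\<close>
  have active: "est_active \<phi> g \<tau> z l = B"
    and M_res: "l' \<in> M \<Longrightarrow> norm (res z l') \<le> eta \<phi> g z l powr \<tau>"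
    and Ap: "ID0_returns \<phi> g \<tau> \<tau>' z l A0 Ap \<Longrightarrow> Bp \<subseteq> Ap \<and> Ap \<subseteq> B"
    and Ap_pos: "ID0_returns \<phi> g \<tau> \<tau>' z l A0 Ap \<Longrightarrow> 0 < dist_KKT \<phi> g zs z l \<Longrightarrow> Ap = Bp"
    if "dist_KKT \<phi> g zs z l \<le> \<delta>3" for z l l' A0 Ap
  proof -
    consider "dist_KKT \<phi> g zs z l = 0" | "0 < dist_KKT \<phi> g zs z l"
      using dist_KKT_nonneg[of z l] by linarith
    then have "est_active \<phi> g \<tau> z l = B \<and> (l' \<in> M \<longrightarrow> norm (res z l') \<le> eta \<phi> g z l powr \<tau>) \<and>
      (ID0_returns \<phi> g \<tau> \<tau>' z l A0 Ap \<longrightarrow> Bp \<subseteq> Ap \<and> Ap \<subseteq> B \<and> (0 < dist_KKT \<phi> g zs z l \<longrightarrow> Ap = Bp))"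
    proof cases
      case 1
      then show ?thesis using at_solution[OF 1] Bp_subset by auto
    next
      case 2
      then show ?thesis using \<delta>1(2)[OF 2] that \<delta>3(3) Bp_subset by fastforce
    qed
    then show "est_active \<phi> g \<tau> z l = B"
      "l' \<in> M \<Longrightarrow> norm (res z l') \<le> eta \<phi> g z l powr \<tau>"
      "ID0_returns \<phi> g \<tau> \<tau>' z l A0 Ap \<Longrightarrow> Bp \<subseteq> Ap \<and> Ap \<subseteq> B"
      "ID0_returns \<phi> g \<tau> \<tau>' z l A0 Ap \<Longrightarrow> 0 < dist_KKT \<phi> g zs z l \<Longrightarrow> Ap = Bp" by blast+
  qed
  have M_feasible: "l' \<in> mult_feasible \<phi> g \<tau> z l I"
    if "dist_KKT \<phi> g zs z l \<le> \<delta>3" "l' \<in> M" "Bp \<subseteq> I" for z l l' I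
    using M_mult_feasible[OF that(2) M_res[OF that(1,2)] that(3)] .
  have returns: "\<exists>A0 Ap. ID0_returns \<phi> g \<tau> \<tau>' z l A0 Ap" if d: "dist_KKT \<phi> g zs z l \<le> \<delta>3" for z l
  proof -
    have "compact (mult_feasible \<phi> g \<tau> z l B)"
      using D(3)[OF order_trans[OF z order_trans[OF d \<delta>3(4)]] order_refl] .
    moreover have "mult_feasible \<phi> g \<tau> z l B \<noteq> {}"
      using M_feasible[OF d _ Bp_subset] M_nonempty by blast
    ultimately show ?thesis
      unfolding ID0_returns_def
      by (intro ID0_loop_exists ID0_LP_solution_exists) (simp_all add: active[OF d])
  qed
  have feasible: "(Min ((\<lambda>i. l'$i) ` Ap), l') \<in> LP_feasible \<phi> g \<tau> z l Ap"
    if d: "dist_KKT \<phi> g zs z l \<le> \<delta>3" and r: "ID0_returns \<phi> g \<tau> \<tau>' z l A0 Ap" and l': "l' \<in> M"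
    for z l A0 Ap l'
    unfolding LP_feasible_def using M_feasible[OF d l'] Ap[OF d r] by auto
  have bdd: "bdd_above (fst ` LP_feasible \<phi> g \<tau> z l Ap)"
    if d: "dist_KKT \<phi> g zs z l \<le> \<delta>3" and r: "ID0_returns \<phi> g \<tau> \<tau>' z l A0 Ap" for z l A0 Ap
  proof -
    have "compact (mult_feasible \<phi> g \<tau> z l Ap)"
      using D(3)[OF order_trans[OF z order_trans[OF d \<delta>3(4)]]] Ap[OF d r] by simp
    from compact_imp_bounded[OF this] obtain b
      where b: "\<And>u. u \<in> mult_feasible \<phi> g \<tau> z l Ap \<Longrightarrow> norm u \<le> b"
      unfolding bounded_iff by blast
    obtain i where i: "i \<in> Ap" using Bp Ap[OF d r] by blast
    show ?thesis
    proof (rule bdd_aboveI)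
      fix t assume "t \<in> fst ` LP_feasible \<phi> g \<tau> z l Ap"
      then obtain u where "t \<le> u$i" "u \<in> mult_feasible \<phi> g \<tau> z l Ap"
        using i unfolding LP_feasible_def by auto
      then show "t \<le> b" using b component_le_norm_cart[of u i] by fastforce
    qed
  qed
  \<comment> \<open>Each KKT multiplier, paired with its smallest component on \<open>Bp\<close>, is
    feasible, so the supremum defining \<open>eps_lambda\<close> is bounded without choosing a
    maximiser.\<close>
  have value_ge: "eps_lambda \<phi> g zs \<le> LP_value \<phi> g \<tau> z l Ap"
    if d: "dist_KKT \<phi> g zs z l \<le> \<delta>3" "0 < dist_KKT \<phi> g zs z l"
      and r: "ID0_returns \<phi> g \<tau> \<tau>' z l A0 Ap" for z l A0 Ap
    unfolding eps_lambda_def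
  proof (rule cSUP_least[OF M_nonempty])
    fix l' assume "l' \<in> M"
    from feasible[OF d(1) r this] show "Min ((\<lambda>i. l'$i) ` Bp) \<le> LP_value \<phi> g \<tau> z l Ap"
      unfolding LP_value_def Ap_pos[OF d(1) r d(2)]
      by (intro cSup_upper bdd[OF d(1) r, unfolded Ap_pos[OF d(1) r d(2)]]) force
  qed
  \<comment> \<open>One summand pays for \<open>norm (z - zs)\<close> in the distance,
    \<open>D\<close> for its share in the multiplier error, and \<open>D * C powr \<tau>\<close> for
    the tolerance.\<close>
  define \<beta> where "\<beta> = (1 + D) + D * C powr \<tau>"
  have "\<beta> > 0" unfolding \<beta>_def using D(1) C(1) by (intro add_pos_pos mult_pos_pos) auto
  have bound: "dist_KKT \<phi> g zs z lh \<le> \<beta> * dist_KKT \<phi> g zs z l powr \<tau>"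
    if d: "dist_KKT \<phi> g zs z l \<le> \<delta>3" and r: "ID0_returns \<phi> g \<tau> \<tau>' z l A0 Ap"
      and sol: "LP_solution \<phi> g \<tau> z l Ap (t, lh)" for z l A0 Ap t lh
  proof -
    define x where "x = dist_KKT \<phi> g zs z l"
    have x: "0 \<le> x" "x \<le> 1" unfolding x_def using dist_KKT_nonneg d \<delta>3(2) by auto
    have "lh \<in> mult_feasible \<phi> g \<tau> z l Ap"
      using sol unfolding LP_solution_def is_arg_max_def LP_feasible_def by auto
    then obtain ls where ls: "ls \<in> M" "norm (lh - ls) \<le> D * (eta \<phi> g z l powr \<tau> + norm (z - zs))"
      using D(4)[OF order_trans[OF z order_trans[OF d \<delta>3(4)]]] Ap[OF d r] by blast
    have "0 \<le> eta \<phi> g z l" unfolding eta_def by simp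
    moreover have "eta \<phi> g z l \<le> C * x" unfolding x_def using C(3) d \<delta>3(5) by simp
    ultimately have "eta \<phi> g z l powr \<tau> \<le> (C * x) powr \<tau>" using \<tau> by (intro powr_mono2) auto
    also have "\<dots> = C powr \<tau> * x powr \<tau>" using C(1) x(1) by (simp add: powr_mult)
    finally have eta: "eta \<phi> g z l powr \<tau> \<le> C powr \<tau> * x powr \<tau>" .
    \<comment> \<open>Linear terms are weakened to order \<tau>, which needs distance at most
      1.\<close>
    have "x \<le> x powr \<tau>" using powr_mono'[of \<tau> 1 x] \<tau> x by simp
    then have n: "norm (z - zs) \<le> x powr \<tau>" using z[of z l] unfolding x_def by linarith
    have "D * (eta \<phi> g z l powr \<tau> + norm (z - zs)) \<le> D * (C powr \<tau> * x powr \<tau> + x powr \<tau>)"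
      using eta n D(1) by (intro mult_left_mono add_mono) auto
    then have "dist_KKT \<phi> g zs z lh \<le> x powr \<tau> + D * (C powr \<tau> * x powr \<tau> + x powr \<tau>)"
      using dist_KKT_le[OF ls(1), of z lh] ls(2) n by linarith
    also have "\<dots> = \<beta> * x powr \<tau>" unfolding \<beta>_def by (simp add: algebra_simps)
    finally show ?thesis unfolding x_def .
  qed
  have nonempty: "LP_feasible \<phi> g \<tau> z l Ap \<noteq> {}"
    if "dist_KKT \<phi> g zs z l \<le> \<delta>3" "ID0_returns \<phi> g \<tau> \<tau>' z l A0 Ap" for z l A0 Ap
    using feasible[OF that] M_nonempty by blast
  show ?thesis
  proof (rule exI[of _ \<delta>3], intro conjI exI[of _ \<beta>] allI impI)
    show "\<delta>3 > 0" by (rule \<delta>3(1))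
    show "\<beta> > 0" by fact
  qed (rule returns nonempty bdd value_ge bound; assumption)+
qed

end
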